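(* Let $n\ge 3$ and let $N\ge 1$ and $\widetilde\alpha_1\ge\widetilde\alpha_2\ge\dots\ge\widetilde\alpha_N\ge 2$ be integers with $\sum_{i=1}^N\widetilde\alpha_i\le n$ and $\widetilde\alpha_1\le n-1$. Put $\widetilde R=n-\sum_{i=1}^N\widetilde\alpha_i$ and let $(\mathcal A^J)_{1\le J\le J_{\max}}$, $J_{\max}=\frac{n!}{\widetilde\alpha_1!\cdots\widetilde\alpha_N!\,\widetilde R!}$, be the balanced family of type $(\widetilde\alpha_1,\dots,\widetilde\alpha_N)$, with multi-indices $\alpha_i^J$ (see context). Let $$\widetilde{p}=\frac{(n-2)!\left(n(n-1)-\sum_{i=1}^N \widetilde\alpha_i(\widetilde\alpha_i-1)\right)}{\widetilde\alpha_1 !\cdots\widetilde\alpha_N !\,\widetilde R !},\qquad \widetilde\delta=n-\widetilde p^{-1}(n-\widetilde\alpha_1)J_{\max}.$$ For a real number $\delta$, consider the assertion $(\ast)_\delta$: there is a constant $C>0$ such that $$\int_{B(0,R)}\prod_{J=1}^{J_{\max}} f_J(x_{\bar\alpha_1^J})\,dx\le C\,R^{\delta}\prod_{J=1}^{J_{\max}}\|f_J\|_{L^{\widetilde p}(\mathbb R^{n-\widetilde\alpha_1})}$$ for every $R>0$ and all nonnegative measurable functions $f_J:\mathbb R^{n-\widetilde\alpha_1}\to[0,\infty)$ such that, for each $J$, the function $x\mapsto f_J(x_{\bar\alpha_1^J})$ on $\mathbb R^n$ is $\mathcal A^J$-symmetric. Then $(\ast)_{\widetilde\delta}$ holds. Moreover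 $\widetilde\delta$ is sharp, in the sense that $(\ast)_\delta$ is false for every $\delta<\widetilde\delta$.
   Context: For $1\le i<j\le n$ let $L_{i,j}=x_i\partial_{x_j}-x_j\partial_{x_i}$. A multi-index is an element $\alpha\in\{0,1\}^n$ with components $(\alpha)_i$; $|\alpha|=\sum_i(\alpha)_i$; $\bar\alpha=(1,\dots,1)-\alpha$; two multi-indices are orthogonal if they have no $1$'s in a common component. For $x\in\mathbb R^n$, $x_\alpha$ denotes the collection of the coordinates $x_i$ with $(\alpha)_i=1$, viewed as a point of $\mathbb R^{|\alpha|}$. Balanced family of type $(\widetilde\alpha_1,\dots,\widetilde\alpha_N)$: let $(\alpha_1^J,\dots,\alpha_N^J)$, $J=1,\dots,J_{\max}$, be an enumeration, each occurring exactly once, of all ordered $N$-tuples of pairwise orthogonal multi-indices in $\{0,1\}^n$ with $|\alpha_i^J|=\widetilde\alpha_i$ for $i=1,\dots,N$; their number is $J_{\max}$. (Ordered tuples are counted separately even when they differ only by permuting multi-indices of equal length.) Set $$\mathcal A^J=\{L_{k,l}:k<l,\ (\alpha_i^J)_k=(\alpha_i^J)_l=1\text{ for some }i\in\{1,\dots,N\}\}.$$ A smooth function $f$ on $\mathbb R^n$ is $\mathcal A^J$-symmetric if $Xf=0$ for all $X\in\mathcal A^J$; equivalently, it is invariant under all rotations acting, for each $i$, as an element of $SO(\widetilde\alpha_i)$ on the coordinates $x_{\alpha_i^J}$ and fixing all remaining coordinates. A measurable function on $\mathbb R^n$ is called $\mathcal A^J$-symmetric if it has this invariance. $B(0,R)$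 is the Euclidean ball in $\mathbb R^n$ of center $0$ and radius $R$. *)

theory Defs
  imports "Jordan_Normal_Form.Determinant" "HOL-Analysis.Analysis"
begin

text \<open>
  Since the dimension n and the dimensions of the coordinate subspaces vary, points of
  \<open>\<real>\<^sup>m\<close> are extensional functions on \<open>{..<m}\<close>: coordinates are numbered from 0,
  while blocks i of a tuple and members J of a family are numbered from 1.
  \<open>lebesgue_Rn m\<close> is m-dimensional Lebesgue measure, on the Lebesgue (not only Borel) sets.
\<close>

definition lebesgue_Rn :: "nat \<Rightarrow> (nat \<Rightarrow> real) measure" where
  "lebesgue_Rn m = completion (\<Pi>\<^sub>M k\<in>{..<m}. (lborel :: real measure))"

definition ball_Rn :: "nat \<Rightarrow> real \<Rightarrow> (nat \<Rightarrow> real) set" where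
  "ball_Rn n R = {x \<in> space (lebesgue_Rn n). L2_set x {..<n} < R}"

text \<open>The norm takes values in \<open>[0,\<infinity>]\<close>; it is only used for real exponents \<open>p \<ge> 1\<close>.\<close>

definition Lp_norm :: "'a measure \<Rightarrow> real \<Rightarrow> ('a \<Rightarrow> real) \<Rightarrow> ennreal" where
  "Lp_norm M p f =
    (let I = (\<integral>\<^sup>+x. ennreal (\<bar>f x\<bar> powr p) \<partial>M)
     in if I = \<infinity> then \<infinity> else ennreal (enn2real I powr (1 / p)))"


section \<open>Multi-indices\<close>

definition multi_indices :: "nat \<Rightarrow> (nat \<Rightarrow> nat) set" where
  "multi_indices n = {..<n} \<rightarrow>\<^sub>E {0, 1}"

definition mi_size :: "nat \<Rightarrow> (nat \<Rightarrow> nat) \<Rightarrow> nat" where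
  "mi_size n \<beta> = (\<Sum>k<n. \<beta> k)"

definition mi_compl :: "nat \<Rightarrow> (nat \<Rightarrow> nat) \<Rightarrow> (nat \<Rightarrow> nat)" where
  "mi_compl n \<beta> = (\<lambda>k\<in>{..<n}. 1 - \<beta> k)"

definition mi_orthogonal :: "nat \<Rightarrow> (nat \<Rightarrow> nat) \<Rightarrow> (nat \<Rightarrow> nat) \<Rightarrow> bool" where
  "mi_orthogonal n \<beta> \<gamma> \<longleftrightarrow> \<not> (\<exists>k<n. \<beta> k = 1 \<and> \<gamma> k = 1)"

text \<open>
  The point \<open>x\<^sub>\<beta>\<close> of \<open>\<real>\<^bsup>|\<beta>|\<^esup>\<close>: the selected coordinates of x in increasing order of
  their indices.
\<close>

definition mi_proj :: "nat \<Rightarrow> (nat \<Rightarrow> nat) \<Rightarrow> (nat \<Rightarrow> real) \<Rightarrow> (nat \<Rightarrow> real)" where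
  "mi_proj n \<beta> x =
    (\<lambda>k\<in>{..<mi_size n \<beta>}. x (sorted_list_of_set {l. l < n \<and> \<beta> l = 1} ! k))"


section \<open>Balanced families\<close>

definition balanced_tuples :: "nat \<Rightarrow> nat \<Rightarrow> (nat \<Rightarrow> nat) \<Rightarrow> (nat \<Rightarrow> nat \<Rightarrow> nat) set" where
  "balanced_tuples n N a =
    {\<beta> \<in> {1..N} \<rightarrow>\<^sub>E multi_indices n.
       (\<forall>i\<in>{1..N}. \<forall>j\<in>{1..N}. i \<noteq> j \<longrightarrow> mi_orthogonal n (\<beta> i) (\<beta> j)) \<and>
       (\<forall>i\<in>{1..N}. mi_size n (\<beta> i) = a i)}"

text \<open>
  The division is exact: \<open>J_max\<close> is a multinomial coefficient, and it is the number of
  balanced tuples (\<open>card_balanced_tuples\<close> below), so enumerations over \<open>{1..J_max n N a}\<close>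
  do exist.
\<close>

definition J_max :: "nat \<Rightarrow> nat \<Rightarrow> (nat \<Rightarrow> nat) \<Rightarrow> nat" where
  "J_max n N a = fact n div ((\<Prod>i=1..N. fact (a i)) * fact (n - (\<Sum>i=1..N. a i)))"

definition p_tilde :: "nat \<Rightarrow> nat \<Rightarrow> (nat \<Rightarrow> nat) \<Rightarrow> real" where
  "p_tilde n N a =
    fact (n - 2) * (real n * (real n - 1) - (\<Sum>i=1..N. real (a i) * (real (a i) - 1)))
      / ((\<Prod>i=1..N. fact (a i)) * fact (n - (\<Sum>i=1..N. a i)))"

definition delta_tilde :: "nat \<Rightarrow> nat \<Rightarrow> (nat \<Rightarrow> nat) \<Rightarrow> real" where
  "delta_tilde n N a =
    real n - inverse (p_tilde n N a) * (real n - real (a 1)) * real (J_max n N a)"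


section \<open>Symmetric functions\<close>

definition SO :: "nat \<Rightarrow> real mat set" where
  "SO m = {A \<in> carrier_mat m m. A * transpose_mat A = 1\<^sub>m m \<and> Determinant.det A = 1}"

text \<open>
  Invariance of a function on \<open>\<real>\<^sup>n\<close> under every simultaneous rotation \<open>x \<mapsto> y\<close> that acts on
  \<open>x\<^bsub>\<beta>\<^sub>i\<^esub>\<close> by an element of \<open>SO(|\<beta>\<^sub>i|)\<close>, for each i, and fixes the coordinates
  outside all the \<open>\<beta>\<^sub>i\<close>.  For smooth functions this amounts to being annihilated by the
  fields \<open>x\<^sub>k\<partial>\<^sub>l - x\<^sub>l\<partial>\<^sub>k\<close> with k, l in a common block.
\<close>

definition block_symmetric ::
  "nat \<Rightarrow> nat \<Rightarrow> (nat \<Rightarrow> nat \<Rightarrow> nat) \<Rightarrow> ((nat \<Rightarrow> real) \<Rightarrow> real) \<Rightarrow> bool" where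
  "block_symmetric n N \<beta> g \<longleftrightarrow>
    (\<forall>A. \<forall>x\<in>space (lebesgue_Rn n). \<forall>y\<in>space (lebesgue_Rn n).
       (\<forall>i\<in>{1..N}. A i \<in> SO (mi_size n (\<beta> i)) \<and>
          Matrix.vec (mi_size n (\<beta> i)) (mi_proj n (\<beta> i) y) =
            A i *\<^sub>v Matrix.vec (mi_size n (\<beta> i)) (mi_proj n (\<beta> i) x)) \<longrightarrow>
       (\<forall>k<n. (\<forall>i\<in>{1..N}. \<beta> i k = 0) \<longrightarrow> y k = x k) \<longrightarrow>
       g y = g x)"


section \<open>The multilinear inequality\<close>

text \<open>The inequality for the family \<open>\<alpha>\<^sup>1, \<dots>, \<alpha>\<^sup>M\<close> with \<open>M = J_max n N a\<close>, where \<open>\<alpha> J i\<close>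
  stands for \<open>\<alpha>\<^sub>i\<^sup>J\<close>.\<close>

definition ball_inequality ::
  "nat \<Rightarrow> nat \<Rightarrow> (nat \<Rightarrow> nat) \<Rightarrow> (nat \<Rightarrow> nat \<Rightarrow> nat \<Rightarrow> nat) \<Rightarrow> real \<Rightarrow> bool" where
  "ball_inequality n N a \<alpha> \<delta> \<longleftrightarrow>
    (\<exists>C>0. \<forall>R>0. \<forall>f :: nat \<Rightarrow> (nat \<Rightarrow> real) \<Rightarrow> real.
       (\<forall>J\<in>{1..J_max n N a}.
          f J \<in> borel_measurable (lebesgue_Rn (n - a 1)) \<and>
          (\<forall>z\<in>space (lebesgue_Rn (n - a 1)). 0 \<le> f J z) \<and>
          block_symmetric n N (\<alpha> J) (\<lambda>x. f J (mi_proj n (mi_compl n (\<alpha> J 1)) x))) \<longrightarrow>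
       (\<integral>\<^sup>+x\<in>ball_Rn n R.
          ennreal (\<Prod>J=1..J_max n N a. f J (mi_proj n (mi_compl n (\<alpha> J 1)) x)) \<partial>lebesgue_Rn n)
       \<le> ennreal (C * R powr \<delta>) *
          (\<Prod>J=1..J_max n N a. Lp_norm (lebesgue_Rn (n - a 1)) (p_tilde n N a) (f J)))"


section \<open>The number of balanced tuples\<close>

lemma card_multi_indices_avoiding:
  assumes U: "U \<subseteq> {..<n}"
  shows "card {\<gamma> \<in> multi_indices n. (\<forall>k\<in>U. \<gamma> k = 0) \<and> mi_size n \<gamma> = m} = (n - card U) choose m"
proof -
  have fU: "finite U" using U finite_subset by blast
  let ?V = "{..<n} - U"
  let ?G = "{\<gamma> \<in> multi_indices n. (\<forall>k\<in>U. \<gamma> k = 0) \<and> mi_size n \<gamma> = m}"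
  let ?h = "\<lambda>X. (\<lambda>k\<in>{..<n}. if k \<in> X then 1 else 0::nat)"
  have size_h: "mi_size n (?h X) = card X" if "X \<subseteq> ?V" for X
  proof -
    have "mi_size n (?h X) = (\<Sum>k<n. if k \<in> X then 1 else 0)"
      by (simp add: mi_size_def)
    also have "\<dots> = card ({..<n} \<inter> X)" by (simp add: sum.If_cases)
    also have "{..<n} \<inter> X = X" using that by auto
    finally show ?thesis .
  qed
  have "bij_betw ?h {X. X \<subseteq> ?V \<and> card X = m} ?G"
  proof (rule bij_betw_byWitness[where f' = "\<lambda>\<gamma>. {k. k < n \<and> \<gamma> k = 1}"])
    show "\<forall>X\<in>{X. X \<subseteq> ?V \<and> card X = m}. {k. k < n \<and> ?h X k = 1} = X"
      by auto
    show *: "\<forall>\<gamma>\<in>?G. ?h {k. k < n \<and> \<gamma> k = 1} = \<gamma>"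
    proof (intro ballI ext)
      fix \<gamma> k assume "\<gamma> \<in> ?G"
      then have "\<gamma> \<in> {..<n} \<rightarrow>\<^sub>E {0,1}" by (simp add: multi_indices_def)
      then show "?h {k. k < n \<and> \<gamma> k = 1} k = \<gamma> k"
        by (cases "k < n") (auto simp: PiE_def extensional_def Pi_def)
    qed
    show "?h ` {X. X \<subseteq> ?V \<and> card X = m} \<subseteq> ?G"
    proof
      fix \<gamma> assume "\<gamma> \<in> ?h ` {X. X \<subseteq> ?V \<and> card X = m}"
      then obtain X where X: "X \<subseteq> ?V" "card X = m" and g: "\<gamma> = ?h X" by blast
      have "mi_size n \<gamma> = m" using size_h[OF X(1)] X(2) g by simp
      moreover have "\<gamma> \<in> multi_indices n" by (auto simp: g multi_indices_def)
      moreover have "\<forall>k\<in>U. \<gamma> k = 0" using X(1) U by (auto simp: g)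
      ultimately show "\<gamma> \<in> ?G" by blast
    qed
    show "(\<lambda>\<gamma>. {k. k < n \<and> \<gamma> k = 1}) ` ?G \<subseteq> {X. X \<subseteq> ?V \<and> card X = m}"
    proof
      fix X assume "X \<in> (\<lambda>\<gamma>. {k. k < n \<and> \<gamma> k = 1}) ` ?G"
      then obtain \<gamma> where g: "\<gamma> \<in> ?G" and X: "X = {k. k < n \<and> \<gamma> k = 1}" by blast
      have sub: "X \<subseteq> ?V" using g U by (auto simp: X)
      have "?h X = \<gamma>" using * g X by blast
      then have "card X = m" using size_h[OF sub] g by simp
      then show "X \<in> {X. X \<subseteq> ?V \<and> card X = m}" using sub by blast
    qed
  qed
  then have "card ?G = card {X. X \<subseteq> ?V \<and> card X = m}"
    by (simp add: bij_betw_same_card)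
  also have "\<dots> = card ?V choose m" by (rule n_subsets) simp
  also have "card ?V = n - card U" using U fU by (simp add: card_Diff_subset)
  finally show ?thesis .
qed

lemma finite_multi_indices: "finite (multi_indices n)"
  by (simp add: multi_indices_def finite_PiE)

lemma finite_balanced_tuples: "finite (balanced_tuples n N a)"
  unfolding balanced_tuples_def
  by (rule finite_subset[of _ "{1..N} \<rightarrow>\<^sub>E multi_indices n"])
    (auto intro!: finite_PiE finite_multi_indices)

lemma card_support_balanced_tuple:
  assumes "\<beta> \<in> balanced_tuples n N a"
  shows "card {k. k < n \<and> (\<exists>i\<in>{1..N}. \<beta> i k = 1)} = (\<Sum>i=1..N. a i)"
proof -
  have b: "\<And>i. i \<in> {1..N} \<Longrightarrow> \<beta> i \<in> multi_indices n"
    "\<And>i j. i \<in> {1..N} \<Longrightarrow> j \<in> {1..N} \<Longrightarrow> i \<noteq> j \<Longrightarrow> mi_orthogonal n (\<beta> i) (\<beta> j)"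
    "\<And>i. i \<in> {1..N} \<Longrightarrow> mi_size n (\<beta> i) = a i"
    using assms by (auto simp: balanced_tuples_def)
  have c: "card {k. k < n \<and> \<beta> i k = 1} = a i" if i: "i \<in> {1..N}" for i
  proof -
    have "a i = (\<Sum>k<n. \<beta> i k)" using b(3)[OF i] by (simp add: mi_size_def)
    also have "\<dots> = (\<Sum>k<n. if \<beta> i k = 1 then 1 else 0)"
      using b(1)[OF i] by (intro sum.cong) (auto simp: multi_indices_def PiE_def Pi_def)
    also have "\<dots> = card ({..<n} \<inter> {k. \<beta> i k = 1})" by (simp add: sum.If_cases)
    also have "{..<n} \<inter> {k. \<beta> i k = 1} = {k. k < n \<and> \<beta> i k = 1}" by auto
    finally show ?thesis by simp
  qed
  have "{k. k < n \<and> (\<exists>i\<in>{1..N}. \<beta> i k = 1)} = (\<Union>i\<in>{1..N}. {k. k < n \<and> \<beta> i k = 1})"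
    by auto
  also have "card \<dots> = (\<Sum>i=1..N. card {k. k < n \<and> \<beta> i k = 1})"
  proof (rule card_UN_disjoint)
    show "\<forall>i\<in>{1..N}. \<forall>j\<in>{1..N}. i \<noteq> j \<longrightarrow>
        {k. k < n \<and> \<beta> i k = 1} \<inter> {k. k < n \<and> \<beta> j k = 1} = {}"
      using b(2) unfolding mi_orthogonal_def by blast
  qed simp_all
  also have "\<dots> = (\<Sum>i=1..N. a i)" using c by (intro sum.cong) auto
  finally show ?thesis .
qed

lemma card_balanced_tuples_Suc:
  "card (balanced_tuples n (Suc N) a) =
    card (balanced_tuples n N a) * ((n - (\<Sum>i=1..N. a i)) choose a (Suc N))"
proof -
  let ?U = "\<lambda>\<beta>. {k. k < n \<and> (\<exists>i\<in>{1..N}. \<beta> i k = 1)}"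
  let ?G = "\<lambda>\<beta>. {\<gamma> \<in> multi_indices n. (\<forall>k\<in>?U \<beta>. \<gamma> k = 0) \<and> mi_size n \<gamma> = a (Suc N)}"
  have iv: "{1..Suc N} = insert (Suc N) {1..N}" by auto
  have mi01: "\<gamma> \<in> multi_indices n \<Longrightarrow> k < n \<Longrightarrow> \<gamma> k = 0 \<or> \<gamma> k = 1" for \<gamma> k
    by (auto simp: multi_indices_def PiE_def Pi_def)
  have "bij_betw (\<lambda>(\<beta>, \<gamma>). \<beta>(Suc N := \<gamma>)) (Sigma (balanced_tuples n N a) ?G)
      (balanced_tuples n (Suc N) a)"
  proof (rule bij_betw_byWitness[where f' = "\<lambda>\<beta>. (restrict \<beta> {1..N}, \<beta> (Suc N))"])
    show "\<forall>x\<in>Sigma (balanced_tuples n N a) ?G.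
        (\<lambda>\<beta>. (restrict \<beta> {1..N}, \<beta> (Suc N))) ((\<lambda>(\<beta>, \<gamma>). \<beta>(Suc N := \<gamma>)) x) = x"
    proof (intro ballI, unfold split_paired_all split_conv)
      fix \<beta> \<gamma> assume "(\<beta>, \<gamma>) \<in> Sigma (balanced_tuples n N a) ?G"
      then have "\<beta> \<in> balanced_tuples n N a" by blast
      then have "\<beta> \<in> extensional {1..N}" by (auto simp: balanced_tuples_def PiE_def)
      then have "restrict (\<beta>(Suc N := \<gamma>)) {1..N} = \<beta>"
        by (intro ext) (auto simp: extensional_def)
      then show "(restrict (\<beta>(Suc N := \<gamma>)) {1..N}, (\<beta>(Suc N := \<gamma>)) (Suc N)) = (\<beta>, \<gamma>)"
        by simp
    qed
    show "\<forall>\<beta>\<in>balanced_tuples n (Suc N) a.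
        (\<lambda>(\<beta>, \<gamma>). \<beta>(Suc N := \<gamma>)) (restrict \<beta> {1..N}, \<beta> (Suc N)) = \<beta>"
    proof
      fix \<beta> assume "\<beta> \<in> balanced_tuples n (Suc N) a"
      then have ext: "\<beta> i = undefined" if "i \<notin> {1..Suc N}" for i
        using that by (auto simp: balanced_tuples_def PiE_def extensional_def)
      have "((restrict \<beta> {1..N})(Suc N := \<beta> (Suc N))) i = \<beta> i" for i
        using ext[of i] by (cases "i \<in> {1..N}") auto
      then show "(\<lambda>(\<beta>, \<gamma>). \<beta>(Suc N := \<gamma>)) (restrict \<beta> {1..N}, \<beta> (Suc N)) = \<beta>"
        by (simp add: fun_eq_iff)
    qed
    show "(\<lambda>(\<beta>, \<gamma>). \<beta>(Suc N := \<gamma>)) ` Sigma (balanced_tuples n N a) ?G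
        \<subseteq> balanced_tuples n (Suc N) a"
    proof clarify
      fix \<beta> \<gamma> assume b: "\<beta> \<in> balanced_tuples n N a"
        and g: "\<gamma> \<in> multi_indices n" "\<forall>k\<in>?U \<beta>. \<gamma> k = 0" "mi_size n \<gamma> = a (Suc N)"
      have orth: "mi_orthogonal n (\<beta> i) \<gamma>" "mi_orthogonal n \<gamma> (\<beta> i)" if "i \<in> {1..N}" for i
      proof -
        have "\<gamma> k = 0" if "k < n" "\<beta> i k = 1" for k
          using g(2) \<open>i \<in> {1..N}\<close> that by blast
        then show "mi_orthogonal n (\<beta> i) \<gamma>" "mi_orthogonal n \<gamma> (\<beta> i)"
          unfolding mi_orthogonal_def by (metis zero_neq_one)+
      qed
      have pie: "\<beta>(Suc N := \<gamma>) \<in> {1..Suc N} \<rightarrow>\<^sub>E multi_indices n"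
        unfolding iv using b g(1) by (intro PiE_fun_upd) (auto simp: balanced_tuples_def)
      show "\<beta>(Suc N := \<gamma>) \<in> balanced_tuples n (Suc N) a"
        unfolding balanced_tuples_def mem_Collect_eq
      proof (intro conjI pie ballI impI)
        fix i j assume ij: "i \<in> {1..Suc N}" "j \<in> {1..Suc N}" "i \<noteq> j"
        show "mi_orthogonal n ((\<beta>(Suc N := \<gamma>)) i) ((\<beta>(Suc N := \<gamma>)) j)"
          using ij b orth[of i] orth[of j] by (auto simp: iv balanced_tuples_def)
      next
        fix i assume "i \<in> {1..Suc N}"
        then show "mi_size n ((\<beta>(Suc N := \<gamma>)) i) = a i"
          using b g(3) by (auto simp: iv balanced_tuples_def)
      qed
    qed
    show "(\<lambda>\<beta>. (restrict \<beta> {1..N}, \<beta> (Suc N))) ` balanced_tuples n (Suc N) a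
        \<subseteq> Sigma (balanced_tuples n N a) ?G"
    proof (rule image_subsetI)
      fix \<beta> assume b: "\<beta> \<in> balanced_tuples n (Suc N) a"
      have b1: "\<beta> i \<in> multi_indices n" if "i \<in> {1..Suc N}" for i
        using b that by (auto simp: balanced_tuples_def)
      have b2: "mi_orthogonal n (\<beta> i) (\<beta> j)"
        if "i \<in> {1..Suc N}" "j \<in> {1..Suc N}" "i \<noteq> j" for i j
        using b that by (auto simp: balanced_tuples_def)
      have b3: "mi_size n (\<beta> i) = a i" if "i \<in> {1..Suc N}" for i
        using b that by (auto simp: balanced_tuples_def)
      have "restrict \<beta> {1..N} \<in> balanced_tuples n N a"
        using b1 b2 b3 by (auto simp: balanced_tuples_def)
      moreover have "\<beta> (Suc N) \<in> ?G (restrict \<beta> {1..N})"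
      proof -
        have "\<beta> (Suc N) k = 0" if k: "k < n" and i: "i \<in> {1..N}" "\<beta> i k = 1" for k i
        proof -
          have "mi_orthogonal n (\<beta> i) (\<beta> (Suc N))" using i by (intro b2) auto
          then show ?thesis
            using k i mi01[OF b1[of "Suc N"] k] by (auto simp: mi_orthogonal_def)
        qed
        then show ?thesis using b1[of "Suc N"] b3[of "Suc N"] by auto
      qed
      ultimately show "(restrict \<beta> {1..N}, \<beta> (Suc N)) \<in> Sigma (balanced_tuples n N a) ?G"
        by blast
    qed
  qed
  then have "card (balanced_tuples n (Suc N) a) = card (Sigma (balanced_tuples n N a) ?G)"
    by (simp add: bij_betw_same_card)
  also have "\<dots> = (\<Sum>\<beta>\<in>balanced_tuples n N a. card (?G \<beta>))"
    using finite_multi_indices[of n] by (intro card_SigmaI finite_balanced_tuples) auto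
  also have "\<dots> = (\<Sum>\<beta>\<in>balanced_tuples n N a. (n - (\<Sum>i=1..N. a i)) choose a (Suc N))"
  proof (rule sum.cong[OF refl])
    fix \<beta> assume b: "\<beta> \<in> balanced_tuples n N a"
    have "?U \<beta> \<subseteq> {..<n}" by auto
    from card_multi_indices_avoiding[OF this, of "a (Suc N)"]
    show "card (?G \<beta>) = (n - (\<Sum>i=1..N. a i)) choose a (Suc N)"
      unfolding card_support_balanced_tuple[OF b] .
  qed
  finally show ?thesis by simp
qed

lemma card_balanced_tuples:
  assumes "(\<Sum>i=1..N. a i) \<le> n"
  shows "card (balanced_tuples n N a) = J_max n N a"
proof -
  have "card (balanced_tuples n N a) * ((\<Prod>i=1..N. fact (a i)) * fact (n - (\<Sum>i=1..N. a i)))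
      = fact n"
    using assms
  proof (induction N)
    case 0
    have "balanced_tuples n 0 a = {\<lambda>_. undefined}" by (auto simp: balanced_tuples_def)
    then show ?case by simp
  next
    case (Suc N)
    let ?s = "n - (\<Sum>i=1..N. a i)"
    have le: "a (Suc N) \<le> ?s" and s: "n - (\<Sum>i=1..Suc N. a i) = ?s - a (Suc N)"
      using Suc.prems by auto
    have "card (balanced_tuples n (Suc N) a) *
        ((\<Prod>i=1..Suc N. fact (a i)) * fact (n - (\<Sum>i=1..Suc N. a i)))
      = card (balanced_tuples n N a) * (\<Prod>i=1..N. fact (a i)) *
        (fact (a (Suc N)) * fact (?s - a (Suc N)) * (?s choose a (Suc N)))"
      unfolding s card_balanced_tuples_Suc by (simp add: algebra_simps)
    also have "fact (a (Suc N)) * fact (?s - a (Suc N)) * (?s choose a (Suc N)) = fact ?s"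
      by (rule binomial_fact_lemma[OF le])
    also have "card (balanced_tuples n N a) * (\<Prod>i=1..N. fact (a i)) * fact ?s = fact n"
      using Suc by (simp add: mult.assoc)
    finally show ?case .
  qed
  then have "J_max n N a =
      card (balanced_tuples n N a) * ((\<Prod>i=1..N. fact (a i)) * fact (n - (\<Sum>i=1..N. a i)))
        div ((\<Prod>i=1..N. fact (a i)) * fact (n - (\<Sum>i=1..N. a i)))"
    by (simp only: J_max_def)
  also have "\<dots> = card (balanced_tuples n N a)"
    by (rule nonzero_mult_div_cancel_right) simp
  finally show ?thesis ..
qed

end

theory Submission
  imports Defs "HOL-Probability.Infinite_Product_Measure" "HOL-Combinatorics.Transposition"
begin

text \<open>
  A coordinate k occurs in the complement of \<open>\<alpha>\<^sub>1\<^sup>J\<close> for exactly \<open>J_max (1 - a\<^sub>1/n)\<close> of the members J, and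
  \<open>\<Sum>a\<^sub>i(a\<^sub>i - 1) \<le> (a\<^sub>1 - 1)n \<le> a\<^sub>1(n - 1)\<close> shows that this number is at most \<open>p_tilde\<close>.  On a product
  of probability spaces, Finner's inequality with an exponent that is at least the multiplicity of
  every coordinate follows from Hoelder's inequality in one variable at a time.  Applied to the
  uniform probability on the cube \<open>[-R,R]\<^sup>n\<close>, which contains the ball, it gives the inequality with
  \<open>C = 2\<^bsup>\<delta>\<^esup>\<close>: the powers of \<open>2R\<close> from the normalisations add up to \<open>delta_tilde\<close>.  For sharpness, let
  every \<open>f\<^sub>J\<close> be the indicator of the ball of radius R, which is invariant under the rotations, and
  let R tend to infinity.
\<close>

section \<open>Finner's inequality on a product of probability spaces\<close>

text \<open>Meant for \<open>r > 0\<close> only: the value at \<open>\<infinity>\<close> is \<open>\<infinity>\<close> and the value at 0 is 0 for every r.\<close>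

definition epow :: "real \<Rightarrow> ennreal \<Rightarrow> ennreal" where
  "epow r x = (if x = \<infinity> then \<infinity> else ennreal (enn2real x powr r))"

lemma epow_ennreal: "0 \<le> x \<Longrightarrow> epow r (ennreal x) = ennreal (x powr r)"
  by (simp add: epow_def)

lemma epow_top [simp]: "epow r top_class.top = top_class.top"
  by (simp add: epow_def)

lemma epow_eq_0_iff [simp]: "epow r x = 0 \<longleftrightarrow> x = 0"
  by (cases x) (auto simp: epow_def)

text \<open>Also correct for \<open>0 * \<infinity> = 0\<close>, because \<open>0 powr r = 0\<close>
  for every \<open>r\<close>.\<close>

lemma epow_mult: "epow r (x * y) = epow r x * epow r y"
  by (cases x; cases y)
    (auto simp: epow_def powr_mult enn2real_mult ennreal_mult ennreal_mult_eq_top_iff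
      ennreal_mult_top ennreal_top_mult)

lemma epow_mono: "0 \<le> r \<Longrightarrow> x \<le> y \<Longrightarrow> epow r x \<le> epow r y"
  by (cases x; cases y) (auto simp: epow_def powr_mono2 ennreal_leI top_unique)

lemma prod_mono_ennreal:
  fixes f g :: "'a \<Rightarrow> ennreal"
  assumes "finite A" "\<And>i. i \<in> A \<Longrightarrow> f i \<le> g i"
  shows "prod f A \<le> prod g A"
  using assms by (induction A rule: finite_induct) (auto intro!: mult_mono)

lemma borel_measurable_epow [measurable]:
  assumes [measurable]: "f \<in> borel_measurable M"
  shows "(\<lambda>x. epow r (f x)) \<in> borel_measurable M"
  unfolding epow_def powr_def by measurable

section \<open>Hoelder's inequality for equal exponents\<close>

text \<open>The weights \<open>1 / p\<close> on the \<open>t j\<close> may sum to less than 1; the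
  missing weight \<open>1 - card S / p\<close> is placed on the constant 1, which leaves the product
  unchanged. This is what later permits multiplicities below \<open>p\<close>.\<close>

lemma weighted_AM_GM:
  fixes t :: "'a \<Rightarrow> real"
  assumes p: "0 < p" "real (card S) \<le> p" and S: "finite S" and t: "\<And>j. j \<in> S \<Longrightarrow> 0 < t j"
  shows "(\<Prod>j\<in>S. t j powr (1 / p)) \<le> (\<Sum>j\<in>S. t j / p) + (1 - real (card S) / p)"
proof -
  define s where "s = (\<Sum>j\<in>S. t j / p) + (1 - real (card S) / p)"
  have c: "0 \<le> 1 - real (card S) / p" using p by simp
  have "0 < s"
  proof (cases "S = {}")
    case False
    then have "0 < (\<Sum>j\<in>S. t j / p)" using S t p by (intro sum_pos) auto
    then show ?thesis using c by (simp add: s_def)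
  qed (simp add: s_def)
  \<comment> \<open>The inequality \<open>ln u \<le> u - 1\<close> at \<open>u = t j / s\<close> and
    at \<open>u = 1 / s\<close>, summed with the weights. Since \<open>s\<close> is the weighted
    mean, the right-hand side is 0.\<close>
  have "(\<Sum>j\<in>S. ln (t j / s) / p) + (1 - real (card S) / p) * ln (1 / s)
      \<le> (\<Sum>j\<in>S. (t j / s - 1) / p) + (1 - real (card S) / p) * (1 / s - 1)"
    using t \<open>0 < s\<close> p c
    by (intro add_mono sum_mono divide_right_mono mult_left_mono ln_le_minus_one) auto
  also have "\<dots> = ((\<Sum>j\<in>S. t j / p) + (1 - real (card S) / p)) / s - 1"
    by (simp add: add_divide_distrib diff_divide_distrib sum_subtractf sum_divide_distrib
        algebra_simps)
  also have "\<dots> = 0" using \<open>0 < s\<close> by (simp flip: s_def)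
  also have "(\<Sum>j\<in>S. ln (t j / s) / p) + (1 - real (card S) / p) * ln (1 / s)
      = (\<Sum>j\<in>S. ln (t j) / p) - ln s"
  proof -
    have "(\<Sum>j\<in>S. ln (t j / s) / p) = (\<Sum>j\<in>S. ln (t j) / p - ln s / p)"
      using t \<open>0 < s\<close> by (intro sum.cong refl) (auto simp: ln_div diff_divide_distrib dest: t)
    then show ?thesis
      using \<open>0 < s\<close> by (simp add: ln_div sum_subtractf algebra_simps)
  qed
  finally have "exp (\<Sum>j\<in>S. ln (t j) / p) \<le> s"
    using \<open>0 < s\<close> by (simp add: ln_ge_iff)
  moreover have "exp (\<Sum>j\<in>S. ln (t j) / p) = (\<Prod>j\<in>S. t j powr (1 / p))"
    using S t by (auto simp: exp_sum powr_def intro!: prod.cong dest: t)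
  ultimately show ?thesis by (simp add: s_def)
qed

text \<open>Degenerate values are settled separately: a factor 0 makes the left-hand side 0, and a
  value \<open>\<infinity>\<close> makes the right-hand side infinite. Otherwise all
  \<open>t j\<close> are positive reals.\<close>

lemma weighted_AM_GM_ennreal:
  fixes t :: "'a \<Rightarrow> ennreal"
  assumes p: "0 < p" "real (card S) \<le> p" and S: "finite S"
  shows "(\<Prod>j\<in>S. epow (1 / p) (t j))
    \<le> (\<Sum>j\<in>S. ennreal (1 / p) * t j) + ennreal (1 - real (card S) / p)"
proof (cases "\<exists>j\<in>S. t j = 0 \<or> t j = top_class.top")
  case True
  then obtain j where j: "j \<in> S" "t j = 0 \<or> t j = top_class.top" by blast
  show ?thesis
  proof (cases "t j = 0")
    case True
    then have "(\<Prod>j\<in>S. epow (1 / p) (t j)) = 0" using j S by auto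
    then show ?thesis by (simp only: zero_le)
  next
    case False
    then have "ennreal (1 / p) * t j = top_class.top" using j p by (simp add: ennreal_mult_top)
    then have "(\<Sum>j\<in>S. ennreal (1 / p) * t j) = top_class.top"
      using member_le_sum[OF j(1) _ S, of "\<lambda>j. ennreal (1 / p) * t j"] by (simp add: top_unique)
    then show ?thesis by simp
  qed
next
  case False
  define u where "u j = enn2real (t j)" for j
  have tu: "t j = ennreal (u j)" "0 < u j" if "j \<in> S" for j
    using False that by (cases "t j"; force simp: u_def)+
  have "(\<Prod>j\<in>S. epow (1 / p) (t j)) = (\<Prod>j\<in>S. ennreal (u j powr (1 / p)))"
    using tu by (intro prod.cong) (auto simp: epow_ennreal less_imp_le)
  also have "\<dots> = ennreal (\<Prod>j\<in>S. u j powr (1 / p))"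
    by (simp add: prod_ennreal)
  also have "\<dots> \<le> ennreal ((\<Sum>j\<in>S. u j / p) + (1 - real (card S) / p))"
    using weighted_AM_GM[OF p S, of u] tu by (intro ennreal_leI) auto
  also have "\<dots> = (\<Sum>j\<in>S. ennreal (u j / p)) + ennreal (1 - real (card S) / p)"
  proof -
    have "(\<Sum>j\<in>S. ennreal (u j / p)) = ennreal (\<Sum>j\<in>S. u j / p)"
      using tu p by (intro sum_ennreal) (auto simp: less_imp_le)
    moreover have "0 \<le> (\<Sum>j\<in>S. u j / p)" using tu p by (intro sum_nonneg) (auto simp: less_imp_le)
    ultimately show ?thesis using p by (simp add: ennreal_plus)
  qed
  also have "(\<Sum>j\<in>S. ennreal (u j / p)) = (\<Sum>j\<in>S. ennreal (1 / p) * t j)"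
    using tu p by (intro sum.cong refl) (simp add: less_imp_le flip: ennreal_mult)
  finally show ?thesis .
qed

text \<open>Hoelder's inequality with the missing weight given to the constant 1, whose integral is
  1 on a probability space. After division by the integrals \<open>G j\<close>, the pointwise mean
  inequality is integrated, and its right-hand side then has integral 1.\<close>

lemma (in prob_space) nn_integral_prod_epow_le:
  assumes p: "0 < p" "real (card S) \<le> p" and S: "finite S"
    and g [measurable]: "\<And>j. j \<in> S \<Longrightarrow> g j \<in> borel_measurable M"
  shows "(\<integral>\<^sup>+x. (\<Prod>j\<in>S. epow (1 / p) (g j x)) \<partial>M) \<le> (\<Prod>j\<in>S. epow (1 / p) (\<integral>\<^sup>+x. g j x \<partial>M))"
proof -
  define G where "G j = (\<integral>\<^sup>+x. g j x \<partial>M)" for j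
  \<comment> \<open>As \<open>0 * \<infinity> = 0\<close>, an infinite \<open>G j\<close> makes the
    right-hand side infinite only if no other one vanishes; vanishing integrals are therefore
    treated first.\<close>
  consider (zero) j where "j \<in> S" "G j = 0"
    | (top) j where "j \<in> S" "G j = top_class.top" "\<forall>i\<in>S. G i \<noteq> 0"
    | (fin) "\<forall>j\<in>S. G j \<noteq> 0 \<and> G j \<noteq> top_class.top" by blast
  then show ?thesis
  proof cases
    case zero
    then have "AE x in M. g j x = 0" by (simp add: G_def nn_integral_0_iff_AE)
    then have "AE x in M. (\<Prod>j\<in>S. epow (1 / p) (g j x)) = 0"
      by eventually_elim (use S zero in auto)
    then have "(\<integral>\<^sup>+x. (\<Prod>j\<in>S. epow (1 / p) (g j x)) \<partial>M) = (\<integral>\<^sup>+x. 0 \<partial>M)"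
      by (rule nn_integral_cong_AE)
    then show ?thesis by simp
  next
    case top
    then have "(\<Prod>j\<in>S. epow (1 / p) (G j)) = top_class.top"
      using S by (auto simp: ennreal_prod_eq_top intro!: bexI[of _ j])
    then show ?thesis by (simp add: G_def)
  next
    case fin
    define P where "P = (\<Prod>j\<in>S. epow (1 / p) (G j))"
    let ?A = "\<lambda>x. (\<Sum>j\<in>S. ennreal (1 / p) * (g j x / G j)) + ennreal (1 - real (card S) / p)"
    have le: "(\<Prod>j\<in>S. epow (1 / p) (g j x)) \<le> P * ?A x" for x
    proof -
      have "(\<Prod>j\<in>S. epow (1 / p) (g j x)) = (\<Prod>j\<in>S. epow (1 / p) (G j) * epow (1 / p) (g j x / G j))"
      proof (intro prod.cong refl)
        fix j assume "j \<in> S"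
        then have "g j x = G j * (g j x / G j)"
          using fin by (metis ennreal_times_divide mult.commute ennreal_mult_divide_eq)
        then show "epow (1 / p) (g j x) = epow (1 / p) (G j) * epow (1 / p) (g j x / G j)"
          by (metis epow_mult)
      qed
      also have "\<dots> \<le> P * ?A x"
        unfolding prod.distrib P_def by (intro mult_left_mono weighted_AM_GM_ennreal p S) simp
      finally show ?thesis .
    qed
    have "(\<integral>\<^sup>+x. (\<Prod>j\<in>S. epow (1 / p) (g j x)) \<partial>M) \<le> (\<integral>\<^sup>+x. P * ?A x \<partial>M)"
      by (intro nn_integral_mono le)
    also have "\<dots> = P * (\<integral>\<^sup>+x. ?A x \<partial>M)"
      by (intro nn_integral_cmult) measurable
    also have "(\<integral>\<^sup>+x. ?A x \<partial>M) = (\<Sum>j\<in>S. ennreal (1 / p) * (G j / G j)) + ennreal (1 - real (card S) / p)"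
      by (simp add: nn_integral_add nn_integral_sum nn_integral_cmult nn_integral_divide G_def
          emeasure_space_1)
    also have "\<dots> = (\<Sum>j\<in>S. ennreal (1 / p)) + ennreal (1 - real (card S) / p)"
      using fin by (simp add: ennreal_divide_self less_top)
    also have "\<dots> = ennreal (real (card S) / p) + ennreal (1 - real (card S) / p)"
      using p by (simp add: ennreal_of_nat_eq_real_of_nat flip: ennreal_mult)
    also have "\<dots> = 1" using p by (simp flip: ennreal_plus)
    finally show ?thesis by (simp add: P_def G_def)
  qed
qed

text \<open>This is Finner's inequality; the coordinates are integrated out one after the other.\<close>

lemma nn_integral_PiM_prod_epow_le:
  assumes M: "prob_space M" and I: "finite I" and p: "0 < p" and S: "finite S"
    and "\<And>j. j \<in> S \<Longrightarrow> g j \<in> borel_measurable (\<Pi>\<^sub>M i\<in>I. M)"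
    and "\<And>j x y. j \<in> S \<Longrightarrow> x \<in> space (\<Pi>\<^sub>M i\<in>I. M) \<Longrightarrow> y \<in> space (\<Pi>\<^sub>M i\<in>I. M) \<Longrightarrow>
      (\<And>k. k \<in> T j \<Longrightarrow> x k = y k) \<Longrightarrow> g j x = g j y"
    and "\<And>k. k \<in> I \<Longrightarrow> real (card {j\<in>S. k \<in> T j}) \<le> p"
  shows "(\<integral>\<^sup>+x. (\<Prod>j\<in>S. epow (1 / p) (g j x)) \<partial>(\<Pi>\<^sub>M i\<in>I. M))
    \<le> (\<Prod>j\<in>S. epow (1 / p) (\<integral>\<^sup>+x. g j x \<partial>(\<Pi>\<^sub>M i\<in>I. M)))"
  using I assms(5-)
proof (induction I arbitrary: g)
  interpret M: prob_space M by fact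
  interpret product_sigma_finite "\<lambda>_. M" by standard
  case empty
  show ?case by (simp add: nn_integral_empty)
next
  interpret M: prob_space M by fact
  interpret product_sigma_finite "\<lambda>_. M" by standard
  case (insert i I)
  note g [measurable] = insert.prems(1)
  \<comment> \<open>For \<open>i \<notin> T j\<close> this is just the value of \<open>g j\<close>,
    since \<open>M\<close> has mass 1, so the product can be kept over all of
    \<open>S\<close>.\<close>
  define g' where "g' j x = (\<integral>\<^sup>+y. g j (x(i := y)) \<partial>M)" for j x
  have g' [measurable]: "g' j \<in> borel_measurable (\<Pi>\<^sub>M i\<in>I. M)" if "j \<in> S" for j
    unfolding g'_def using that by measurable
  have upd: "x(i := y) \<in> space (\<Pi>\<^sub>M i\<in>insert i I. M)"
    if "x \<in> space (\<Pi>\<^sub>M i\<in>I. M)" "y \<in> space M" for x y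
    using that by (auto simp: space_PiM PiE_def extensional_def)
  have inner: "(\<integral>\<^sup>+y. (\<Prod>j\<in>S. epow (1 / p) (g j (x(i := y)))) \<partial>M) \<le> (\<Prod>j\<in>S. epow (1 / p) (g' j x))"
    if x: "x \<in> space (\<Pi>\<^sub>M i\<in>I. M)" for x
  proof -
    \<comment> \<open>With the other coordinates frozen, only the factors in \<open>S1\<close> vary
      with coordinate \<open>i\<close>. They number at most \<open>p\<close>, so the one-variable
      inequality applies to them, while the factors in \<open>S0\<close> are pulled out as
      constants.\<close>
    define S1 where "S1 = {j\<in>S. i \<in> T j}"
    define S0 where "S0 = {j\<in>S. i \<notin> T j}"
    have fin: "finite S1" "finite S0" and disj: "S1 \<inter> S0 = {}" and un: "S = S1 \<union> S0"
      using S by (auto simp: S1_def S0_def)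
    have [measurable]: "(\<lambda>y. g j (x(i := y))) \<in> borel_measurable M" if "j \<in> S" for j
      using x that by measurable
    have const: "g j (x(i := y)) = g' j x" if "j \<in> S0" and y: "y \<in> space M" for j y
    proof -
      have "g' j x = (\<integral>\<^sup>+z. g j (x(i := y)) \<partial>M)"
        unfolding g'_def
      proof (intro nn_integral_cong)
        fix z assume "z \<in> space M"
        then show "g j (x(i := z)) = g j (x(i := y))"
          using that x by (intro insert.prems(2) upd) (auto simp: S0_def)
      qed
      then show ?thesis by (simp add: M.emeasure_space_1)
    qed
    have "(\<integral>\<^sup>+y. (\<Prod>j\<in>S. epow (1 / p) (g j (x(i := y)))) \<partial>M)
        = (\<integral>\<^sup>+y. (\<Prod>j\<in>S0. epow (1 / p) (g' j x)) * (\<Prod>j\<in>S1. epow (1 / p) (g j (x(i := y)))) \<partial>M)"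
      unfolding un prod.union_disjoint[OF fin disj]
      by (intro nn_integral_cong) (simp add: const mult.commute)
    also have "\<dots> = (\<Prod>j\<in>S0. epow (1 / p) (g' j x)) * (\<integral>\<^sup>+y. (\<Prod>j\<in>S1. epow (1 / p) (g j (x(i := y)))) \<partial>M)"
      using un by (intro nn_integral_cmult borel_measurable_prod_ennreal) auto
    also have "\<dots> \<le> (\<Prod>j\<in>S0. epow (1 / p) (g' j x)) * (\<Prod>j\<in>S1. epow (1 / p) (g' j x))"
      unfolding g'_def using un insert.prems(3)[of i]
      by (intro mult_left_mono M.nn_integral_prod_epow_le p fin) (auto simp: S1_def)
    also have "\<dots> = (\<Prod>j\<in>S. epow (1 / p) (g' j x))"
      unfolding un prod.union_disjoint[OF fin disj] by (rule mult.commute)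
    finally show ?thesis .
  qed
  have "(\<integral>\<^sup>+x. (\<Prod>j\<in>S. epow (1 / p) (g j x)) \<partial>(\<Pi>\<^sub>M i\<in>insert i I. M))
      = (\<integral>\<^sup>+x. (\<integral>\<^sup>+y. (\<Prod>j\<in>S. epow (1 / p) (g j (x(i := y)))) \<partial>M) \<partial>(\<Pi>\<^sub>M i\<in>I. M))"
    using insert.hyps by (intro product_nn_integral_insert) auto
  also have "\<dots> \<le> (\<integral>\<^sup>+x. (\<Prod>j\<in>S. epow (1 / p) (g' j x)) \<partial>(\<Pi>\<^sub>M i\<in>I. M))"
    by (intro nn_integral_mono inner)
  also have "\<dots> \<le> (\<Prod>j\<in>S. epow (1 / p) (\<integral>\<^sup>+x. g' j x \<partial>(\<Pi>\<^sub>M i\<in>I. M)))"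
  proof (rule insert.IH)
    \<comment> \<open>Integrating out coordinate \<open>i\<close> creates no new dependence, so the
      same sets \<open>T j\<close>, and with them the same multiplicities, serve for the induction
      hypothesis.\<close>
    fix j x y assume j: "j \<in> S" and x: "x \<in> space (\<Pi>\<^sub>M i\<in>I. M)" and y: "y \<in> space (\<Pi>\<^sub>M i\<in>I. M)"
      and eq: "\<And>k. k \<in> T j \<Longrightarrow> x k = y k"
    show "g' j x = g' j y"
      unfolding g'_def using j x y eq by (intro nn_integral_cong insert.prems(2) upd) auto
  qed (use insert.prems(3) in auto)
  also have "\<dots> = (\<Prod>j\<in>S. epow (1 / p) (\<integral>\<^sup>+x. g j x \<partial>(\<Pi>\<^sub>M i\<in>insert i I. M)))"
    unfolding g'_def using insert.hyps
    by (intro prod.cong refl arg_cong[of _ _ "epow (1 / p)"] product_nn_integral_insert[symmetric]) auto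
  finally show ?case .
qed

section \<open>Products of densities\<close>

text \<open>A product measure is determined by its values on boxes, and on a box the integral of the
  product density factorises. Sigma-finiteness of the density is a separate hypothesis because
  \<open>h\<close> may take the value \<open>\<infinity>\<close>.\<close>

lemma PiM_density:
  assumes I: "finite I" and M: "sigma_finite_measure M" and h [measurable]: "h \<in> borel_measurable M"
    and D: "sigma_finite_measure (density M h)"
  shows "(\<Pi>\<^sub>M i\<in>I. density M h) = density (\<Pi>\<^sub>M i\<in>I. M) (\<lambda>x. \<Prod>i\<in>I. h (x i))"
proof -
  interpret M: product_sigma_finite "\<lambda>_. M" using M by (simp add: product_sigma_finite_def)
  interpret D: product_sigma_finite "\<lambda>_. density M h" using D by (simp add: product_sigma_finite_def)
  have "density (\<Pi>\<^sub>M i\<in>I. M) (\<lambda>x. \<Prod>i\<in>I. h (x i)) = (\<Pi>\<^sub>M i\<in>I. density M h)"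
  proof (rule D.PiM_eqI[OF I])
    show "sets (density (\<Pi>\<^sub>M i\<in>I. M) (\<lambda>x. \<Prod>i\<in>I. h (x i))) = sets (\<Pi>\<^sub>M i\<in>I. density M h)"
      by (simp cong: sets_PiM_cong)
    fix A assume "\<And>i. i \<in> I \<Longrightarrow> A i \<in> sets (density M h)"
    then have A [measurable]: "\<And>i. i \<in> I \<Longrightarrow> A i \<in> sets M" by simp
    have [measurable]: "Pi\<^sub>E I A \<in> sets (\<Pi>\<^sub>M i\<in>I. M)" using I A by (rule sets_PiM_I_finite)
    have "emeasure (density (\<Pi>\<^sub>M i\<in>I. M) (\<lambda>x. \<Prod>i\<in>I. h (x i))) (Pi\<^sub>E I A)
        = (\<integral>\<^sup>+x. (\<Prod>i\<in>I. h (x i)) * indicator (Pi\<^sub>E I A) x \<partial>(\<Pi>\<^sub>M i\<in>I. M))"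
      by (intro emeasure_density) measurable
    also have "\<dots> = (\<integral>\<^sup>+x. (\<Prod>i\<in>I. h (x i) * indicator (A i) (x i)) \<partial>(\<Pi>\<^sub>M i\<in>I. M))"
    proof (intro nn_integral_cong)
      fix x assume "x \<in> space (\<Pi>\<^sub>M i\<in>I. M)"
      then have "indicator (Pi\<^sub>E I A) x = (\<Prod>i\<in>I. indicator (A i) (x i) :: ennreal)"
        using I by (auto simp: indicator_def space_PiM PiE_iff)
      then show "(\<Prod>i\<in>I. h (x i)) * indicator (Pi\<^sub>E I A) x = (\<Prod>i\<in>I. h (x i) * indicator (A i) (x i))"
        by (simp add: prod.distrib)
    qed
    also have "\<dots> = (\<Prod>i\<in>I. \<integral>\<^sup>+x. h x * indicator (A i) x \<partial>M)"
      using I by (intro M.product_nn_integral_prod) measurable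
    also have "\<dots> = (\<Prod>i\<in>I. emeasure (density M h) (A i))"
      using A by (intro prod.cong refl emeasure_density[symmetric]) auto
    finally show "emeasure (density (\<Pi>\<^sub>M i\<in>I. M) (\<lambda>x. \<Prod>i\<in>I. h (x i))) (Pi\<^sub>E I A)
      = (\<Prod>i\<in>I. emeasure (density M h) (A i))" .
  qed
  then show ?thesis ..
qed

section \<open>Transfer to Lebesgue measure on a ball\<close>

lemma Lp_norm_eq_epow:
  "Lp_norm M p f = epow (1 / p) (\<integral>\<^sup>+x. ennreal (\<bar>f x\<bar> powr p) \<partial>M)"
  by (simp add: Lp_norm_def epow_def Let_def)

definition cube_density :: "real \<Rightarrow> real \<Rightarrow> ennreal" where
  "cube_density R y = ennreal (1 / (2 * R)) * indicator {-R..R} y"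

lemma measurable_cube_density [measurable]: "cube_density R \<in> borel_measurable borel"
  unfolding cube_density_def[abs_def] by measurable

lemma prob_space_cube_density:
  assumes "0 < R"
  shows "prob_space (density lborel (cube_density R))"
proof
  have "emeasure (density lborel (cube_density R)) UNIV
      = (\<integral>\<^sup>+y. ennreal (1 / (2 * R)) * indicator {-R..R} y \<partial>lborel)"
    by (subst emeasure_density) (simp_all add: cube_density_def)
  also have "\<dots> = ennreal (1 / (2 * R)) * ennreal (2 * R)"
    using assms by (subst nn_integral_cmult_indicator) auto
  also have "\<dots> = 1"
    using assms by (simp flip: ennreal_mult)
  finally show "emeasure (density lborel (cube_density R)) (space (density lborel (cube_density R))) = 1"
    by simp
qed

lemma PiM_cube_density:
  assumes "finite I" "0 < R"
  shows "(\<Pi>\<^sub>M i\<in>I. density lborel (cube_density R))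
    = density (\<Pi>\<^sub>M i\<in>I. lborel) (\<lambda>x. \<Prod>i\<in>I. cube_density R (x i))"
proof (rule PiM_density[OF assms(1) sigma_finite_lborel])
  interpret prob_space "density lborel (cube_density R)" using assms(2) by (rule prob_space_cube_density)
  show "sigma_finite_measure (density lborel (cube_density R))" by standard
qed simp

lemma prod_cube_density:
  assumes "finite I" "0 < R"
  shows "(\<Prod>i\<in>I. cube_density R (x i))
    = ennreal ((1 / (2 * R)) ^ card I) * indicator {x. \<forall>i\<in>I. \<bar>x i\<bar> \<le> R} x"
proof -
  have "(\<Prod>i\<in>I. indicator {-R..R} (x i) :: ennreal) = indicator {x. \<forall>i\<in>I. \<bar>x i\<bar> \<le> R} x"
    using assms(1) by (auto simp: indicator_def abs_le_iff minus_le_iff)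
  then show ?thesis
    using assms by (simp add: cube_density_def prod.distrib ennreal_power)
qed

lemma ball_Rn_coord_bound:
  assumes "x \<in> ball_Rn n R" "k < n"
  shows "\<bar>x k\<bar> \<le> R"
proof -
  \<comment> \<open>The bound of an entry by \<open>L2_set\<close> concerns the signed entry, so it
    is applied to the absolute values.\<close>
  have "\<bar>x k\<bar> \<le> L2_set (\<lambda>k. \<bar>x k\<bar>) {..<n}"
    using assms(2) by (intro member_le_L2_set) auto
  also have "\<dots> = L2_set x {..<n}" by (simp add: L2_set_def)
  finally show ?thesis using assms(1) by (simp add: ball_Rn_def)
qed

text \<open>Each \<open>t j\<close> selects \<open>m\<close> of the \<open>n\<close> coordinates.
  Passing from Lebesgue measure to the uniform probability on the cube costs
  \<open>(2 * R) ^ n\<close>; passing back inside each of the \<open>card S\<close> norms gains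
  \<open>(2 * R) powr (- m / p)\<close>. Together these give the exponent.\<close>

proposition local_Finner_inequality:
  fixes f :: "'j \<Rightarrow> (nat \<Rightarrow> real) \<Rightarrow> real" and t :: "'j \<Rightarrow> nat \<Rightarrow> nat"
  assumes S: "finite S" and p: "0 < p" and R: "0 < R"
    and f: "\<And>j. j \<in> S \<Longrightarrow> f j \<in> borel_measurable (lebesgue_Rn m)"
    and nonneg: "\<And>j z. j \<in> S \<Longrightarrow> z \<in> space (lebesgue_Rn m) \<Longrightarrow> 0 \<le> f j z"
    and inj: "\<And>j. j \<in> S \<Longrightarrow> inj_on (t j) {..<m}"
    and into: "\<And>j. j \<in> S \<Longrightarrow> t j \<in> {..<m} \<rightarrow> {..<n}"
    and count: "\<And>k. k < n \<Longrightarrow> real (card {j\<in>S. k \<in> t j ` {..<m}}) \<le> p"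
  shows "(\<integral>\<^sup>+x\<in>ball_Rn n R. ennreal (\<Prod>j\<in>S. f j (\<lambda>k\<in>{..<m}. x (t j k))) \<partial>lebesgue_Rn n)
    \<le> ennreal ((2 * R) powr (real n - real m * real (card S) / p)) *
      (\<Prod>j\<in>S. Lp_norm (lebesgue_Rn m) p (f j))"
proof -
  let ?L = "\<lambda>n. \<Pi>\<^sub>M k\<in>{..<n::nat}. (lborel :: real measure)"
  let ?\<mu> = "density lborel (cube_density R)"
  let ?P = "\<lambda>n. \<Pi>\<^sub>M k\<in>{..<n::nat}. ?\<mu>"
  let ?h = "\<lambda>n x. \<Prod>k<n::nat. cube_density R (x k)"
  define Q where "Q n = {x :: nat \<Rightarrow> real. \<forall>k\<in>{..<n::nat}. \<bar>x k\<bar> \<le> R}" for n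
  define \<pi> where "\<pi> j x = (\<lambda>k\<in>{..<m}. x (t j k) :: real)" for j x
  interpret \<mu>: prob_space ?\<mu> using R by (rule prob_space_cube_density)
  have P_eq: "?P n = density (?L n) (?h n)" for n
    using R by (intro PiM_cube_density) auto
  have h_eq: "?h n x = ennreal ((1 / (2 * R)) ^ n) * indicator (Q n) x" for n x
    unfolding Q_def using R by (subst prod_cube_density) auto
  have sets_P: "sets (?P n) = sets (?L n)" for n by (simp add: P_eq)
  have h_meas [measurable]: "?h n \<in> borel_measurable (?L n)" for n by measurable
  have \<pi>_meas: "\<pi> j \<in> ?P n \<rightarrow>\<^sub>M ?P m" if "j \<in> S" for j
    unfolding \<pi>_def using into[OF that]
    by (intro measurable_restrict measurable_component_singleton) auto
  \<comment> \<open>Injectivity of \<open>t j\<close> makes the selected coordinates distinct, hence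
    independent, so the image measure is again a product.\<close>
  have \<pi>_distr: "distr (?P n) (?P m) (\<pi> j) = ?P m" if "j \<in> S" for j
    unfolding \<pi>_def
    using distr_PiM_reindex[of "{..<n}" "\<lambda>_. ?\<mu>" "t j" "{..<m}"] inj[OF that] into[OF that]
      \<mu>.prob_space_axioms by simp
  have \<pi>_space: "\<pi> j x \<in> space (?L m)" for j x
    by (simp add: \<pi>_def space_PiM)

  \<comment> \<open>The \<open>f j\<close> are measurable only for the completed measure. They are
    replaced by functions measurable for the uncompleted product, to which the product-measure
    lemmas apply.\<close>
  have "\<exists>f'\<in>borel_measurable (?L m). AE z in ?L m. f j z = f' z" if "j \<in> S" for j
    using f[OF that] unfolding lebesgue_Rn_def by (rule completion_ex_borel_measurable_real)
  then obtain f' where f' [measurable]: "\<And>j. j \<in> S \<Longrightarrow> f' j \<in> borel_measurable (?L m)"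
    and ae: "\<And>j. j \<in> S \<Longrightarrow> AE z in ?L m. f j z = f' j z"
    by metis
  \<comment> \<open>The absolute value is needed since \<open>f' j\<close> may be negative on a null
    set. Taking \<open>epow (1 / p)\<close> of \<open>g j\<close> gives back \<open>f j\<close>
    wherever the two functions agree.\<close>
  define g where "g j z = ennreal (\<bar>f' j z\<bar> powr p)" for j z
  have g [measurable]: "g j \<in> borel_measurable (?L m)" if "j \<in> S" for j
    unfolding g_def powr_def using that by measurable
  have g\<pi>: "(\<lambda>x. g j (\<pi> j x)) \<in> borel_measurable (?P n)" if "j \<in> S" for j
    using g[OF that] \<pi>_meas[OF that] by (simp add: measurable_compose measurable_cong_sets[OF sets_P refl])
  define F where "F x = (\<Prod>j\<in>S. epow (1 / p) (g j (\<pi> j x)))" for x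
  have F_P: "F \<in> borel_measurable (?P n)"
    unfolding F_def using g\<pi> by (intro borel_measurable_prod_ennreal borel_measurable_epow) auto
  then have F [measurable]: "F \<in> borel_measurable (?L n)"
    by (simp add: measurable_cong_sets[OF sets_P refl])

  \<comment> \<open>The exceptional null set must be pulled back along \<open>\<pi> j\<close>. It is
    null for the uniform probability on the \<open>m\<close>-cube, which is the image of the one on
    the \<open>n\<close>-cube; positivity of the density on \<open>Q n\<close> returns the claim to
    Lebesgue measure.\<close>
  have ae\<pi>: "AE x in ?L n. x \<in> Q n \<longrightarrow> f j (\<pi> j x) = f' j (\<pi> j x)" if j: "j \<in> S" for j
  proof -
    have "AE z in ?P m. f j z = f' j z"
      unfolding P_eq AE_density[OF h_meas] using ae[OF j] by eventually_elim simp
    then have "AE x in ?P n. f j (\<pi> j x) = f' j (\<pi> j x)"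
      by (subst (asm) \<pi>_distr[OF j, symmetric]) (rule AE_distrD[OF \<pi>_meas[OF j]])
    then have "AE x in ?L n. 0 < ?h n x \<longrightarrow> f j (\<pi> j x) = f' j (\<pi> j x)"
      unfolding P_eq AE_density[OF h_meas] .
    then show ?thesis
      by eventually_elim (use R in \<open>simp add: h_eq\<close>)
  qed
  then have "AE x in ?L n. \<forall>j\<in>S. x \<in> Q n \<longrightarrow> f j (\<pi> j x) = f' j (\<pi> j x)"
    using S by (intro eventually_ball_finite) auto
  \<comment> \<open>On the ball the density is the constant \<open>(1 / (2 * R)) ^ n\<close>, which
    the factor \<open>(2 * R) ^ n\<close> cancels; off the ball the left-hand side is 0.\<close>
  then have bound: "AE x in ?L n. ennreal (\<Prod>j\<in>S. f j (\<pi> j x)) * indicator (ball_Rn n R) x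
      \<le> ennreal ((2 * R) ^ n) * (?h n x * F x)"
  proof eventually_elim
    case (elim x)
    show ?case
    proof (cases "x \<in> ball_Rn n R")
      case True
      then have Q: "x \<in> Q n" using ball_Rn_coord_bound by (auto simp: Q_def)
      have "ennreal (\<Prod>j\<in>S. f j (\<pi> j x)) = (\<Prod>j\<in>S. ennreal (f j (\<pi> j x)))"
        using nonneg \<pi>_space by (subst prod_ennreal) (auto simp: lebesgue_Rn_def)
      also have "\<dots> = F x"
        unfolding F_def
      proof (intro prod.cong refl)
        fix j assume j: "j \<in> S"
        then have "0 \<le> f' j (\<pi> j x)" "f j (\<pi> j x) = f' j (\<pi> j x)"
          using nonneg[OF j, of "\<pi> j x"] \<pi>_space elim Q by (auto simp: lebesgue_Rn_def)
        then show "ennreal (f j (\<pi> j x)) = epow (1 / p) (g j (\<pi> j x))"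
          using p by (simp add: g_def epow_ennreal powr_powr)
      qed
      also have "\<dots> = ennreal ((2 * R) ^ n * (1 / (2 * R)) ^ n) * F x"
        using R by (simp add: power_one_over)
      also have "\<dots> = ennreal ((2 * R) ^ n) * (?h n x * F x)"
      proof -
        have h: "?h n x = ennreal ((1 / (2 * R)) ^ n)"
          using Q unfolding h_eq by (simp del: power_one_over)
        have "ennreal ((2 * R) ^ n * (1 / (2 * R)) ^ n) = ennreal ((2 * R) ^ n) * ennreal ((1 / (2 * R)) ^ n)"
          using R by (intro ennreal_mult) auto
        then show ?thesis unfolding h by (simp only: mult.assoc)
      qed
      finally show ?thesis using True by simp
    qed simp
  qed

  have g_int: "(\<integral>\<^sup>+x. g j (\<pi> j x) \<partial>?P n) \<le> ennreal ((1 / (2 * R)) ^ m) * (\<integral>\<^sup>+z. g j z \<partial>?L m)"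
    if j: "j \<in> S" for j
  proof -
    have gP: "g j \<in> borel_measurable (?P m)" using g[OF j] by (simp add: measurable_cong_sets[OF sets_P refl])
    have "(\<integral>\<^sup>+x. g j (\<pi> j x) \<partial>?P n) = (\<integral>\<^sup>+z. g j z \<partial>distr (?P n) (?P m) (\<pi> j))"
      by (rule nn_integral_distr[OF \<pi>_meas[OF j], symmetric]) (simp add: gP)
    also have "\<dots> = (\<integral>\<^sup>+z. ?h m z * g j z \<partial>?L m)"
      unfolding \<pi>_distr[OF j] unfolding P_eq by (rule nn_integral_density[OF h_meas g[OF j]])
    \<comment> \<open>The density is bounded by its value on the cube, which extends the integral
      from the cube to the whole space.\<close>
    also have "\<dots> \<le> (\<integral>\<^sup>+z. ennreal ((1 / (2 * R)) ^ m) * g j z \<partial>?L m)"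
      unfolding h_eq by (intro nn_integral_mono) (auto simp: indicator_def)
    also have "\<dots> = ennreal ((1 / (2 * R)) ^ m) * (\<integral>\<^sup>+z. g j z \<partial>?L m)"
      by (rule nn_integral_cmult[OF g[OF j]])
    finally show ?thesis .
  qed
  have norm: "Lp_norm (lebesgue_Rn m) p (f j) = epow (1 / p) (\<integral>\<^sup>+z. g j z \<partial>?L m)" if j: "j \<in> S" for j
  proof -
    have "(\<integral>\<^sup>+z. ennreal (\<bar>f j z\<bar> powr p) \<partial>?L m) = (\<integral>\<^sup>+z. g j z \<partial>?L m)"
      by (rule nn_integral_cong_AE) (use ae[OF j] in \<open>eventually_elim, simp add: g_def\<close>)
    then show ?thesis by (simp add: Lp_norm_eq_epow lebesgue_Rn_def nn_integral_completion)
  qed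

  have "(\<integral>\<^sup>+x\<in>ball_Rn n R. ennreal (\<Prod>j\<in>S. f j (\<lambda>k\<in>{..<m}. x (t j k))) \<partial>lebesgue_Rn n)
      = (\<integral>\<^sup>+x. ennreal (\<Prod>j\<in>S. f j (\<pi> j x)) * indicator (ball_Rn n R) x \<partial>?L n)"
    by (simp add: lebesgue_Rn_def nn_integral_completion \<pi>_def)
  also have "\<dots> \<le> (\<integral>\<^sup>+x. ennreal ((2 * R) ^ n) * (?h n x * F x) \<partial>?L n)"
    by (rule nn_integral_mono_AE[OF bound])
  also have "\<dots> = ennreal ((2 * R) ^ n) * (\<integral>\<^sup>+x. ?h n x * F x \<partial>?L n)"
    by (rule nn_integral_cmult) measurable
  also have "(\<integral>\<^sup>+x. ?h n x * F x \<partial>?L n) = (\<integral>\<^sup>+x. F x \<partial>?P n)"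
    unfolding P_eq by (rule nn_integral_density[OF h_meas F, symmetric])
  also have "\<dots> \<le> (\<Prod>j\<in>S. epow (1 / p) (\<integral>\<^sup>+x. g j (\<pi> j x) \<partial>?P n))"
    unfolding F_def
  proof (rule nn_integral_PiM_prod_epow_le[where T = "\<lambda>j. t j ` {..<m}"])
    show "prob_space ?\<mu>" by (rule \<mu>.prob_space_axioms)
    fix j and x y :: "nat \<Rightarrow> real" assume "\<And>k. k \<in> t j ` {..<m} \<Longrightarrow> x k = y k"
    then have "\<pi> j x = \<pi> j y" by (auto simp: \<pi>_def)
    then show "g j (\<pi> j x) = g j (\<pi> j y)" by simp
  qed (use p S g\<pi> count in auto)
  also have "\<dots> \<le> (\<Prod>j\<in>S. epow (1 / p) (ennreal ((1 / (2 * R)) ^ m) * (\<integral>\<^sup>+z. g j z \<partial>?L m)))"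
    using S
  proof (rule prod_mono_ennreal)
    show "epow (1 / p) (\<integral>\<^sup>+x. g j (\<pi> j x) \<partial>?P n)
        \<le> epow (1 / p) (ennreal ((1 / (2 * R)) ^ m) * (\<integral>\<^sup>+z. g j z \<partial>?L m))" if "j \<in> S" for j
      using p that by (intro epow_mono g_int) auto
  qed
  also have "\<dots> = (\<Prod>j\<in>S. ennreal (((1 / (2 * R)) ^ m) powr (1 / p)) * Lp_norm (lebesgue_Rn m) p (f j))"
    using R by (intro prod.cong refl) (simp add: epow_mult epow_ennreal norm)
  also have "\<dots> = ennreal ((((1 / (2 * R)) ^ m) powr (1 / p)) ^ card S)
      * (\<Prod>j\<in>S. Lp_norm (lebesgue_Rn m) p (f j))"
    by (simp add: prod.distrib ennreal_power)
  also have "ennreal ((2 * R) ^ n) * (ennreal ((((1 / (2 * R)) ^ m) powr (1 / p)) ^ card S)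
      * (\<Prod>j\<in>S. Lp_norm (lebesgue_Rn m) p (f j)))
    = ennreal ((2 * R) ^ n * (((1 / (2 * R)) ^ m) powr (1 / p)) ^ card S)
      * (\<Prod>j\<in>S. Lp_norm (lebesgue_Rn m) p (f j))"
    using R by (subst ennreal_mult) (auto simp: mult.assoc)
  also have "(2 * R) ^ n * (((1 / (2 * R)) ^ m) powr (1 / p)) ^ card S
      = (2 * R) powr (real n - real m * real (card S) / p)"
  proof -
    have "(((1 / (2 * R)) ^ m) powr (1 / p)) ^ card S = (2 * R) powr (- (real m * real (card S) / p))"
      using R by (simp add: powr_powr powr_realpow[symmetric] powr_power powr_divide powr_minus_divide)
    then show ?thesis
      using R by (simp add: powr_diff powr_minus_divide powr_realpow)
  qed
  \<comment> \<open>Two of the estimates concern only the second factor of a product; the remaining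
    premises state that multiplication by \<open>ennreal ((2 * R) ^ n)\<close> is monotone.\<close>
  finally show ?thesis by this (simp_all add: mult_left_mono)
qed

section \<open>Counting multi-indices\<close>

text \<open>Named so that \<open>mi_proj\<close> takes the form of the coordinate selections in
  \<open>local_Finner_inequality\<close>.\<close>

definition mi_coord :: "nat \<Rightarrow> (nat \<Rightarrow> nat) \<Rightarrow> nat \<Rightarrow> nat" where
  "mi_coord n \<gamma> k = sorted_list_of_set {l. l < n \<and> \<gamma> l = 1} ! k"

lemma mi_proj_eq: "mi_proj n \<gamma> x = (\<lambda>k\<in>{..<mi_size n \<gamma>}. x (mi_coord n \<gamma> k))"
  by (simp add: mi_proj_def mi_coord_def)

lemma multi_indices_cases:
  assumes "\<gamma> \<in> multi_indices n" "k < n"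
  obtains "\<gamma> k = 0" | "\<gamma> k = 1"
  using assms by (auto simp: multi_indices_def PiE_def Pi_def)

lemma mi_size_eq_card:
  assumes "\<gamma> \<in> multi_indices n"
  shows "mi_size n \<gamma> = card {l. l < n \<and> \<gamma> l = 1}"
proof -
  have "mi_size n \<gamma> = (\<Sum>k<n. if \<gamma> k = 1 then 1 else 0)"
    unfolding mi_size_def using assms by (intro sum.cong) (auto elim: multi_indices_cases)
  also have "\<dots> = card ({..<n} \<inter> {k. \<gamma> k = 1})" by (simp add: sum.If_cases)
  also have "{..<n} \<inter> {k. \<gamma> k = 1} = {l. l < n \<and> \<gamma> l = 1}" by auto
  finally show ?thesis .
qed

lemma bij_betw_mi_coord:
  assumes "\<gamma> \<in> multi_indices n"
  shows "bij_betw (mi_coord n \<gamma>) {..<mi_size n \<gamma>} {l. l < n \<and> \<gamma> l = 1}"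
  unfolding mi_coord_def mi_size_eq_card[OF assms]
  by (intro bij_betw_nth) auto

lemma mi_compl_in_multi_indices: "mi_compl n \<gamma> \<in> multi_indices n"
proof -
  \<comment> \<open>Subtraction of natural numbers is truncated at 0.\<close>
  have "1 - \<gamma> k = 0 \<or> 1 - \<gamma> k = 1" for k by arith
  then show ?thesis by (auto simp: mi_compl_def multi_indices_def)
qed

lemma mi_compl_support:
  "{l. l < n \<and> mi_compl n \<gamma> l = 1} = {l. l < n \<and> \<gamma> l = 0}"
  by (auto simp: mi_compl_def)

lemma mi_size_mi_compl:
  assumes "\<gamma> \<in> multi_indices n"
  shows "mi_size n (mi_compl n \<gamma>) = n - mi_size n \<gamma>"
proof -
  have "{l. l < n \<and> \<gamma> l = 0} = {..<n} - {l. l < n \<and> \<gamma> l = 1}"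
    using assms by (auto elim: multi_indices_cases)
  moreover have "mi_size n (mi_compl n \<gamma>) = card {l. l < n \<and> \<gamma> l = 0}"
    unfolding mi_size_eq_card[OF mi_compl_in_multi_indices] mi_compl_support ..
  moreover have "card ({..<n} - {l. l < n \<and> \<gamma> l = 1}) = n - card {l. l < n \<and> \<gamma> l = 1}"
    by (subst card_Diff_subset) auto
  ultimately show ?thesis
    using assms by (simp add: mi_size_eq_card)
qed

lemma balanced_tuplesD:
  assumes "\<beta> \<in> balanced_tuples n N a" "i \<in> {1..N}"
  shows "\<beta> i \<in> multi_indices n" "mi_size n (\<beta> i) = a i"
    "j \<in> {1..N} \<Longrightarrow> i \<noteq> j \<Longrightarrow> mi_orthogonal n (\<beta> i) (\<beta> j)"
  using assms by (auto simp: balanced_tuples_def)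

section \<open>The multinomial coefficient and the exponent\<close>

text \<open>The division in \<open>J_max\<close> is exact: blocks are split off one at a time, and
  \<open>fact b * fact c\<close> divides \<open>fact (b + c)\<close>.\<close>

lemma J_max_mult:
  assumes "(\<Sum>i=1..N. a i) \<le> n"
  shows "J_max n N a * ((\<Prod>i=1..N. fact (a i)) * fact (n - (\<Sum>i=1..N. a i))) = fact n"
proof -
  have "(\<Prod>i=1..N. fact (a i)) * fact (n - (\<Sum>i=1..N. a i)) dvd (fact n :: nat)"
    using assms
  proof (induction N)
    case (Suc N)
    let ?s = "n - (\<Sum>i=1..N. a i)"
    have le: "a (Suc N) \<le> ?s" and s: "n - (\<Sum>i=1..Suc N. a i) = ?s - a (Suc N)"
      using Suc.prems by auto
    have "fact (a (Suc N)) * fact (?s - a (Suc N)) dvd (fact ?s :: nat)"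
      using fact_fact_dvd_fact[of "a (Suc N)" "?s - a (Suc N)"]
      unfolding le_add_diff_inverse[OF le] .
    then have "(\<Prod>i=1..N. fact (a i)) * (fact (a (Suc N)) * fact (?s - a (Suc N)))
        dvd (\<Prod>i=1..N. fact (a i)) * (fact ?s :: nat)"
      by (rule mult_dvd_mono[OF dvd_refl])
    also have "\<dots> dvd fact n" using Suc by simp
    finally show ?case unfolding s by (simp add: mult.assoc)
  qed simp
  then show ?thesis by (simp add: J_max_def)
qed

text \<open>Follows from \<open>fact n = n * (n - 1) * fact (n - 2)\<close>. In this form the
  exponent is seen to be the number of members \<open>J\<close> for which two given distinct
  coordinates lie in no common block.\<close>

lemma p_tilde_eq:
  assumes "2 \<le> n" "(\<Sum>i=1..N. a i) \<le> n"
  shows "p_tilde n N a = real (J_max n N a) *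
    (1 - (\<Sum>i=1..N. real (a i) * (real (a i) - 1)) / (real n * (real n - 1)))"
proof -
  let ?D = "(\<Prod>i=1..N. fact (a i)) * fact (n - (\<Sum>i=1..N. a i)) :: real"
  have D: "?D > 0" by (intro mult_pos_pos prod_pos) auto
  have "real (J_max n N a) * ?D = fact n"
    using arg_cong[OF J_max_mult[OF assms(2)], of real] by simp
  also have "(fact n :: real) = real n * (real n - 1) * fact (n - 2)"
  proof -
    obtain k where "n = Suc (Suc k)" using assms(1) by (metis add_2_eq_Suc le_Suc_ex)
    then show ?thesis by (simp add: algebra_simps)
  qed
  finally have J: "fact (n - 2) / ?D = real (J_max n N a) / (real n * (real n - 1))"
    using D assms(1) by (simp add: field_simps)
  have "p_tilde n N a = fact (n - 2) / ?D * (real n * (real n - 1) - (\<Sum>i=1..N. real (a i) * (real (a i) - 1)))"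
    by (simp add: p_tilde_def)
  also have "\<dots> = real (J_max n N a) *
    (1 - (\<Sum>i=1..N. real (a i) * (real (a i) - 1)) / (real n * (real n - 1)))"
    unfolding J using assms(1) by (simp add: field_simps)
  finally show ?thesis .
qed

section \<open>Double counting by permuting coordinates\<close>

text \<open>Permutations act by precomposition; the two restrictions keep the result extensional at
  both levels, as \<open>balanced_tuples\<close> demands.\<close>

definition permute_tuple :: "nat \<Rightarrow> nat \<Rightarrow> (nat \<Rightarrow> nat) \<Rightarrow> (nat \<Rightarrow> nat \<Rightarrow> nat) \<Rightarrow> nat \<Rightarrow> nat \<Rightarrow> nat" where
  "permute_tuple n N \<sigma> \<beta> = (\<lambda>i\<in>{1..N}. \<lambda>k\<in>{..<n}. \<beta> i (\<sigma> k))"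

lemma permute_tuple_in_balanced_tuples:
  assumes \<sigma>: "bij_betw \<sigma> {..<n} {..<n}" and \<beta>: "\<beta> \<in> balanced_tuples n N a"
  shows "permute_tuple n N \<sigma> \<beta> \<in> balanced_tuples n N a"
proof -
  have lt: "\<sigma> k < n" if "k < n" for k
    using bij_betwE[OF \<sigma>] that by auto
  have "permute_tuple n N \<sigma> \<beta> i \<in> multi_indices n" if "i \<in> {1..N}" for i
    using balanced_tuplesD(1)[OF \<beta> that] that lt
    by (auto simp: permute_tuple_def multi_indices_def PiE_def Pi_def)
  moreover have "mi_size n (permute_tuple n N \<sigma> \<beta> i) = a i" if "i \<in> {1..N}" for i
    using balanced_tuplesD(2)[OF \<beta> that] that sum.reindex_bij_betw[OF \<sigma>, of "\<beta> i"]
    by (simp add: permute_tuple_def mi_size_def)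
  moreover have "mi_orthogonal n (permute_tuple n N \<sigma> \<beta> i) (permute_tuple n N \<sigma> \<beta> j)"
    if "i \<in> {1..N}" "j \<in> {1..N}" "i \<noteq> j" for i j
    using balanced_tuplesD(3)[OF \<beta> that] that lt by (auto simp: permute_tuple_def mi_orthogonal_def)
  moreover have "permute_tuple n N \<sigma> \<beta> \<in> extensional {1..N}"
    by (simp add: permute_tuple_def)
  ultimately show ?thesis by (auto simp: balanced_tuples_def PiE_def)
qed

lemma permute_tuple_involution:
  assumes "\<And>k. \<sigma> (\<sigma> k) = k" "\<And>k. k < n \<Longrightarrow> \<sigma> k < n" and \<beta>: "\<beta> \<in> balanced_tuples n N a"
  shows "permute_tuple n N \<sigma> (permute_tuple n N \<sigma> \<beta>) = \<beta>"
proof (intro ext)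
  fix i k
  show "permute_tuple n N \<sigma> (permute_tuple n N \<sigma> \<beta>) i k = \<beta> i k"
  proof (cases "i \<in> {1..N}")
    case True
    then have "\<beta> i \<in> extensional {..<n}"
      using balanced_tuplesD(1)[OF \<beta> True] by (simp add: multi_indices_def PiE_def)
    then show ?thesis
      using True assms(1,2) by (auto simp: permute_tuple_def extensional_def)
  next
    case False
    then have "\<beta> i = undefined" using \<beta> by (auto simp: balanced_tuples_def PiE_def extensional_def)
    then show ?thesis using False by (auto simp: permute_tuple_def)
  qed
qed

text \<open>The transposition of \<open>k\<close> and \<open>l\<close> is an involution on balanced
  tuples that exchanges the two sets.\<close>

lemma card_balanced_tuples_containing_eq:
  assumes "i \<in> {1..N}" "k < n" "l < n"
  shows "card {\<beta> \<in> balanced_tuples n N a. \<beta> i k = 1} = card {\<beta> \<in> balanced_tuples n N a. \<beta> i l = 1}"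
proof -
  define \<sigma> where "\<sigma> = Transposition.transpose k l"
  have inv: "\<sigma> (\<sigma> j) = j" and lt: "j < n \<Longrightarrow> \<sigma> j < n" for j
    using assms by (auto simp: \<sigma>_def Transposition.transpose_def)
  have bij: "bij_betw \<sigma> {..<n} {..<n}"
    by (rule bij_betw_byWitness[where f' = \<sigma>]) (use inv lt in auto)
  have "bij_betw (permute_tuple n N \<sigma>) {\<beta> \<in> balanced_tuples n N a. \<beta> i k = 1}
      {\<beta> \<in> balanced_tuples n N a. \<beta> i l = 1}"
    using assms permute_tuple_in_balanced_tuples[OF bij] permute_tuple_involution[OF inv lt]
    by (intro bij_betw_byWitness[where f' = "permute_tuple n N \<sigma>"])
      (auto simp: permute_tuple_def \<sigma>_def)
  then show ?thesis by (rule bij_betw_same_card)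
qed

text \<open>Double counting of the pairs of a tuple \<beta> and a coordinate \<open>l\<close> with
  \<open>\<beta> i l = 1\<close>: all coordinates contribute equally by symmetry, and every tuple
  contributes \<open>a i\<close>.\<close>

lemma card_balanced_tuples_containing:
  assumes i: "i \<in> {1..N}" and k: "k < n" and le: "(\<Sum>i=1..N. a i) \<le> n"
  shows "n * card {\<beta> \<in> balanced_tuples n N a. \<beta> i k = 1} = J_max n N a * a i"
proof -
  let ?B = "balanced_tuples n N a"
  have "n * card {\<beta> \<in> ?B. \<beta> i k = 1} = (\<Sum>l<n. card {\<beta> \<in> ?B. \<beta> i l = 1})"
  proof -
    have "(\<Sum>l<n. card {\<beta> \<in> ?B. \<beta> i l = 1}) = (\<Sum>l<n. card {\<beta> \<in> ?B. \<beta> i k = 1})"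
      using card_balanced_tuples_containing_eq[OF i _ k] by (intro sum.cong) auto
    then show ?thesis by simp
  qed
  also have "\<dots> = (\<Sum>l<n. \<Sum>\<beta>\<in>?B. \<beta> i l)"
  proof (intro sum.cong refl)
    fix l assume l: "l \<in> {..<n}"
    have "(\<Sum>\<beta>\<in>?B. \<beta> i l) = (\<Sum>\<beta>\<in>?B. if \<beta> i l = 1 then 1 else 0)"
    proof (intro sum.cong refl)
      fix \<beta> assume "\<beta> \<in> ?B"
      then show "\<beta> i l = (if \<beta> i l = 1 then 1 else 0)"
        using balanced_tuplesD(1)[OF \<open>\<beta> \<in> ?B\<close> i] l by (auto elim: multi_indices_cases[of "\<beta> i" n l])
    qed
    also have "\<dots> = card (?B \<inter> {\<beta>. \<beta> i l = 1})"
      by (simp add: sum.If_cases finite_balanced_tuples)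
    also have "?B \<inter> {\<beta>. \<beta> i l = 1} = {\<beta> \<in> ?B. \<beta> i l = 1}" by auto
    finally show "card {\<beta> \<in> ?B. \<beta> i l = 1} = (\<Sum>\<beta>\<in>?B. \<beta> i l)" by simp
  qed
  also have "\<dots> = (\<Sum>\<beta>\<in>?B. mi_size n (\<beta> i))"
    unfolding mi_size_def by (rule sum.swap)
  also have "\<dots> = (\<Sum>\<beta>\<in>?B. a i)"
    using balanced_tuplesD(2)[OF _ i] by (intro sum.cong) auto
  also have "\<dots> = J_max n N a * a i"
    using card_balanced_tuples[OF le] by simp
  finally show ?thesis .
qed

lemma card_balanced_tuples_avoiding:
  assumes i: "i \<in> {1..N}" and k: "k < n" and le: "(\<Sum>i=1..N. a i) \<le> n"
  shows "real (card {\<beta> \<in> balanced_tuples n N a. \<beta> i k = 0}) = real (J_max n N a) * (1 - real (a i) / real n)"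
proof -
  let ?B = "balanced_tuples n N a"
  have "{\<beta> \<in> ?B. \<beta> i k = 0} = ?B - {\<beta> \<in> ?B. \<beta> i k = 1}"
  proof -
    have "\<beta> i k = 0 \<or> \<beta> i k = 1" if "\<beta> \<in> ?B" for \<beta>
      using balanced_tuplesD(1)[OF that i] k by (auto elim: multi_indices_cases)
    then show ?thesis by force
  qed
  then have "card {\<beta> \<in> ?B. \<beta> i k = 0} = card ?B - card {\<beta> \<in> ?B. \<beta> i k = 1}"
    by (simp add: card_Diff_subset finite_balanced_tuples)
  moreover have "card {\<beta> \<in> ?B. \<beta> i k = 1} \<le> card ?B"
    by (intro card_mono finite_balanced_tuples) auto
  ultimately have "real (card {\<beta> \<in> ?B. \<beta> i k = 0}) = real (card ?B) - real (card {\<beta> \<in> ?B. \<beta> i k = 1})"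
    by simp
  also have "real (card {\<beta> \<in> ?B. \<beta> i k = 1}) = real (J_max n N a) * real (a i) / real n"
    using arg_cong[OF card_balanced_tuples_containing[OF assms], of real] k by (simp add: field_simps)
  finally show ?thesis using card_balanced_tuples[OF le] by (simp add: algebra_simps)
qed

text \<open>The left-hand side is the multiplicity of a coordinate among the complements of the
  first blocks, so this is the condition under which Finner's inequality applies with exponent
  \<open>p_tilde\<close>.\<close>

lemma p_tilde_ge:
  assumes "2 \<le> n" and N: "1 \<le> N" and mono: "\<And>i. i \<in> {1..N} \<Longrightarrow> a i \<le> a 1"
    and pos: "1 \<le> a 1" and le: "(\<Sum>i=1..N. a i) \<le> n"
  shows "real (J_max n N a) * (1 - real (a 1) / real n) \<le> p_tilde n N a"
proof -
  have a1n: "a 1 \<le> n"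
    using member_le_sum[of 1 "{1..N}" a] N le by simp
  have "(\<Sum>i=1..N. real (a i) * (real (a i) - 1)) \<le> (\<Sum>i=1..N. real (a i) * (real (a 1) - 1))"
    using mono by (intro sum_mono mult_left_mono) auto
  also have "\<dots> = real (\<Sum>i=1..N. a i) * (real (a 1) - 1)"
    by (simp add: sum_distrib_right)
  also have "\<dots> \<le> real n * (real (a 1) - 1)"
    using le pos by (intro mult_right_mono) (auto simp del: of_nat_sum)
  \<comment> \<open>Expanded, this says \<open>a 1 \<le> n\<close>.\<close>
  also have "\<dots> \<le> real (a 1) * (real n - 1)"
    using a1n by (simp add: algebra_simps)
  finally have "(\<Sum>i=1..N. real (a i) * (real (a i) - 1)) / (real n * (real n - 1))
      \<le> real (a 1) * (real n - 1) / (real n * (real n - 1))"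
    using assms(1) by (intro divide_right_mono) auto
  also have "\<dots> = real (a 1) / real n" using assms(1) by simp
  finally show ?thesis
    unfolding p_tilde_eq[OF assms(1) le] by (intro mult_left_mono) auto
qed

section \<open>Rotation-invariant test functions\<close>

lemma SO_sum_squares:
  fixes x y :: "nat \<Rightarrow> real"
  assumes A: "A \<in> SO m" and eq: "Matrix.vec m y = A *\<^sub>v Matrix.vec m x"
  shows "(\<Sum>k<m. (y k)\<^sup>2) = (\<Sum>k<m. (x k)\<^sup>2)"
proof -
  have carrier: "A \<in> carrier_mat m m" and "A * transpose_mat A = 1\<^sub>m m"
    using A by (auto simp: SO_def)
  \<comment> \<open>\<open>SO\<close> provides a right inverse, but the norm computation needs a
    left inverse; for square matrices one implies the other.\<close>
  then have orth: "transpose_mat A * A = 1\<^sub>m m"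
    by (intro mat_mult_left_right_inverse[of A]) auto
  have sq: "Matrix.vec m z \<bullet> Matrix.vec m z = (\<Sum>k<m. (z k)\<^sup>2)" for z :: "nat \<Rightarrow> real"
    by (simp add: scalar_prod_def power2_eq_square atLeast0LessThan)
  let ?x = "Matrix.vec m x"
  have "(A *\<^sub>v ?x) \<bullet> (A *\<^sub>v ?x) = (transpose_mat A *\<^sub>v (A *\<^sub>v ?x)) \<bullet> ?x"
    using carrier by (subst transpose_vec_mult_scalar[of A m m]) auto
  also have "transpose_mat A *\<^sub>v (A *\<^sub>v ?x) = (transpose_mat A * A) *\<^sub>v ?x"
    using carrier by (intro assoc_mult_mat_vec[symmetric, of _ m m _ m]) auto
  also have "\<dots> = ?x" unfolding orth by simp
  finally show ?thesis unfolding sq[symmetric] eq .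
qed

text \<open>Turns sums over a projected point into sums over the support, which can be split into
  blocks.\<close>

lemma sum_mi_proj:
  assumes "\<gamma> \<in> multi_indices n"
  shows "(\<Sum>k<mi_size n \<gamma>. h (mi_proj n \<gamma> x k)) = (\<Sum>l | l < n \<and> \<gamma> l = 1. h (x l))"
  using sum.reindex_bij_betw[OF bij_betw_mi_coord[OF assms], of "\<lambda>l. h (x l)"]
  by (simp add: mi_proj_eq)

text \<open>The rotations preserve the sum of squares over each block and fix the free coordinates.
  The complement of the first block is a union of whole blocks and free coordinates, so its sum of
  squares is invariant.\<close>

lemma block_symmetric_norm_compl:
  assumes N: "1 \<le> N" and \<beta>: "\<beta> \<in> balanced_tuples n N a"
  shows "block_symmetric n N \<beta>
    (\<lambda>x. h (\<Sum>k<mi_size n (mi_compl n (\<beta> 1)). (mi_proj n (mi_compl n (\<beta> 1)) x k)\<^sup>2))"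
  unfolding block_symmetric_def
proof (intro allI ballI impI)
  fix A and x y :: "nat \<Rightarrow> real"
  assume rot: "\<forall>i\<in>{1..N}. A i \<in> SO (mi_size n (\<beta> i)) \<and>
      Matrix.vec (mi_size n (\<beta> i)) (mi_proj n (\<beta> i) y) =
        A i *\<^sub>v Matrix.vec (mi_size n (\<beta> i)) (mi_proj n (\<beta> i) x)"
    and fixed: "\<forall>k<n. (\<forall>i\<in>{1..N}. \<beta> i k = 0) \<longrightarrow> y k = x k"
  define B where "B i = {l. l < n \<and> \<beta> i l = 1}" for i
  define F where "F = {l. l < n \<and> (\<forall>i\<in>{1..N}. \<beta> i l = 0)}"
  have mi: "\<beta> i \<in> multi_indices n" if "i \<in> {1..N}" for i
    using balanced_tuplesD(1)[OF \<beta> that] .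
  have mi1: "\<beta> 1 \<in> multi_indices n" using N by (intro mi) auto
  have mi01: "\<beta> i l = 0 \<or> \<beta> i l = 1" if "i \<in> {1..N}" "l < n" for i l
    using multi_indices_cases[OF mi] that by blast
  have disj: "B i \<inter> B j = {}" if "i \<in> {1..N}" "j \<in> {1..N}" "i \<noteq> j" for i j
    using balanced_tuplesD(3)[OF \<beta> that] by (auto simp: B_def mi_orthogonal_def)
  have compl: "{l. l < n \<and> mi_compl n (\<beta> 1) l = 1} = (\<Union>i\<in>{2..N}. B i) \<union> F"
  proof (intro Set.set_eqI iffI)
    fix l assume "l \<in> {l. l < n \<and> mi_compl n (\<beta> 1) l = 1}"
    then have l: "l < n" "\<beta> 1 l = 0" unfolding mi_compl_support by auto
    show "l \<in> (\<Union>i\<in>{2..N}. B i) \<union> F"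
    proof (cases "l \<in> F")
      case False
      then obtain i where "i \<in> {1..N}" "\<beta> i l \<noteq> 0" using l by (auto simp: F_def)
      then have i: "i \<in> {1..N}" "\<beta> i l = 1" using mi01[of i l] l(1) by auto
      then have "i \<noteq> 1" using l by auto
      then have "i \<in> {2..N}" using i by auto
      then show ?thesis using i l by (auto simp: B_def)
    qed simp
  next
    fix l assume l: "l \<in> (\<Union>i\<in>{2..N}. B i) \<union> F"
    then have "l < n" by (auto simp: B_def F_def)
    moreover have "B 1 \<inter> B i = {}" if "i \<in> {2..N}" for i
      using that by (intro disj) auto
    then have "l \<notin> B 1" if "l \<notin> F" using l that by blast
    then have "l \<notin> B 1" using N by (cases "l \<in> F") (auto simp: B_def F_def)
    ultimately show "l \<in> {l. l < n \<and> mi_compl n (\<beta> 1) l = 1}"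
      unfolding mi_compl_support
      using mi01[of 1 l] N by (auto simp: B_def)
  qed
  have block: "(\<Sum>l\<in>B i. (y l)\<^sup>2) = (\<Sum>l\<in>B i. (x l)\<^sup>2)" if i: "i \<in> {1..N}" for i
    using SO_sum_squares[of "A i" "mi_size n (\<beta> i)" "mi_proj n (\<beta> i) y" "mi_proj n (\<beta> i) x"] rot i
    by (simp add: sum_mi_proj[OF mi[OF i], of "\<lambda>t. t\<^sup>2"] B_def)
  have split: "(\<Sum>l | l < n \<and> mi_compl n (\<beta> 1) l = 1. (z l)\<^sup>2)
      = (\<Sum>i\<in>{2..N}. \<Sum>l\<in>B i. (z l)\<^sup>2) + (\<Sum>l\<in>F. (z l)\<^sup>2)" for z :: "nat \<Rightarrow> real"
  proof -
    have "(\<Sum>l\<in>(\<Union>i\<in>{2..N}. B i) \<union> F. (z l)\<^sup>2) = (\<Sum>l\<in>(\<Union>i\<in>{2..N}. B i). (z l)\<^sup>2) + (\<Sum>l\<in>F. (z l)\<^sup>2)"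
      by (intro sum.union_disjoint) (auto simp: B_def F_def)
    also have "(\<Sum>l\<in>(\<Union>i\<in>{2..N}. B i). (z l)\<^sup>2) = (\<Sum>i\<in>{2..N}. \<Sum>l\<in>B i. (z l)\<^sup>2)"
      using disj by (intro sum.UNION_disjoint) (auto simp: B_def)
    finally show ?thesis unfolding compl .
  qed
  have "(\<Sum>l\<in>F. (y l)\<^sup>2) = (\<Sum>l\<in>F. (x l)\<^sup>2)"
    using fixed by (intro sum.cong) (auto simp: F_def)
  moreover have "(\<Sum>i\<in>{2..N}. \<Sum>l\<in>B i. (y l)\<^sup>2) = (\<Sum>i\<in>{2..N}. \<Sum>l\<in>B i. (x l)\<^sup>2)"
    by (intro sum.cong refl block) auto
  ultimately show "h (\<Sum>k<mi_size n (mi_compl n (\<beta> 1)). (mi_proj n (mi_compl n (\<beta> 1)) y k)\<^sup>2) =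
      h (\<Sum>k<mi_size n (mi_compl n (\<beta> 1)). (mi_proj n (mi_compl n (\<beta> 1)) x k)\<^sup>2)"
    unfolding sum_mi_proj[OF mi_compl_in_multi_indices, of "\<lambda>t. t\<^sup>2"] split by simp
qed

section \<open>Volumes of balls compared with cubes\<close>

lemma ball_Rn_in_sets: "ball_Rn n R \<in> sets (lebesgue_Rn n)"
proof -
  have "{x \<in> space (\<Pi>\<^sub>M k\<in>{..<n}. (lborel :: real measure)). L2_set x {..<n} < R}
      \<in> sets (\<Pi>\<^sub>M k\<in>{..<n}. (lborel :: real measure))"
    unfolding L2_set_def by measurable
  then show ?thesis by (simp add: ball_Rn_def lebesgue_Rn_def sets_completionI_sets)
qed

lemma emeasure_centered_box:
  assumes "0 \<le> r"
  shows "emeasure (\<Pi>\<^sub>M k\<in>{..<n}. (lborel :: real measure)) ({..<n} \<rightarrow>\<^sub>E {-r..r}) = ennreal ((2 * r) ^ n)"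
proof -
  interpret product_sigma_finite "\<lambda>_. lborel :: real measure" by standard
  show ?thesis
    using assms by (subst emeasure_PiM) (auto simp: ennreal_power)
qed

text \<open>Only the order \<open>R ^ n\<close> matters for sharpness, so an inscribed cube replaces
  the exact volume.\<close>

lemma emeasure_ball_Rn_ge:
  assumes R: "0 < R"
  shows "ennreal ((2 * (R / (real n + 1))) ^ n) \<le> (\<integral>\<^sup>+x. indicator (ball_Rn n R) x \<partial>lebesgue_Rn n)"
proof -
  let ?L = "\<Pi>\<^sub>M k\<in>{..<n}. (lborel :: real measure)"
  \<comment> \<open>With \<open>n + 1\<close> in place of \<open>n\<close> the sum of the absolute
    values stays strictly below \<open>R\<close>, as the open ball requires.\<close>
  let ?r = "R / (real n + 1)"
  have sub: "{..<n} \<rightarrow>\<^sub>E {-?r..?r} \<subseteq> ball_Rn n R"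
  proof
    fix x assume x: "x \<in> {..<n} \<rightarrow>\<^sub>E {-?r..?r}"
    have "L2_set x {..<n} \<le> (\<Sum>k<n. \<bar>x k\<bar>)" by (rule L2_set_le_sum_abs)
    also have "\<dots> \<le> (\<Sum>k<n. ?r)"
    proof (rule sum_mono)
      fix k assume "k \<in> {..<n}"
      then show "\<bar>x k\<bar> \<le> ?r" using PiE_mem[OF x] by (simp add: abs_le_iff minus_le_iff)
    qed
    also have "\<dots> < R" using R by (simp add: field_simps)
    finally show "x \<in> ball_Rn n R"
      using x by (auto simp: ball_Rn_def lebesgue_Rn_def space_PiM)
  qed
  have "{..<n} \<rightarrow>\<^sub>E {-?r..?r} \<in> sets ?L" by (intro sets_PiM_I_finite) auto
  then have "emeasure ?L ({..<n} \<rightarrow>\<^sub>E {-?r..?r}) = (\<integral>\<^sup>+x. indicator ({..<n} \<rightarrow>\<^sub>E {-?r..?r}) x \<partial>?L)"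
    by (rule nn_integral_indicator[symmetric])
  also have "\<dots> \<le> (\<integral>\<^sup>+x. indicator (ball_Rn n R) x \<partial>?L)"
    using sub by (intro nn_integral_mono) (auto simp: indicator_def)
  finally have "emeasure ?L ({..<n} \<rightarrow>\<^sub>E {-?r..?r}) \<le> (\<integral>\<^sup>+x. indicator (ball_Rn n R) x \<partial>?L)" .
  then show ?thesis
    using R emeasure_centered_box[of ?r n] by (simp add: lebesgue_Rn_def nn_integral_completion)
qed

text \<open>The circumscribed cube has an explicit volume of the right order in
  \<open>R\<close>.\<close>

lemma Lp_norm_indicator_ball_Rn_le:
  assumes R: "0 < R" and p: "0 < p"
  shows "Lp_norm (lebesgue_Rn m) p (indicator (ball_Rn m R)) \<le> ennreal (((2 * R) ^ m) powr (1 / p))"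
proof -
  let ?L = "\<Pi>\<^sub>M k\<in>{..<m}. (lborel :: real measure)"
  have "(\<integral>\<^sup>+x. ennreal (\<bar>indicator (ball_Rn m R) x\<bar> powr p) \<partial>?L)
      \<le> (\<integral>\<^sup>+x. indicator ({..<m} \<rightarrow>\<^sub>E {-R..R}) x \<partial>?L)"
  proof (intro nn_integral_mono)
    fix x assume "x \<in> space ?L"
    then have "x \<in> {..<m} \<rightarrow>\<^sub>E {-R..R}" if "x \<in> ball_Rn m R"
      using ball_Rn_coord_bound[OF that]
      by (auto simp: space_PiM abs_le_iff PiE_iff minus_le_iff)
    then show "ennreal (\<bar>indicator (ball_Rn m R) x\<bar> powr p) \<le> indicator ({..<m} \<rightarrow>\<^sub>E {-R..R}) x"
      by (auto simp: indicator_def)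
  qed
  also have "\<dots> = emeasure ?L ({..<m} \<rightarrow>\<^sub>E {-R..R})"
    by (intro nn_integral_indicator sets_PiM_I_finite) auto
  also have "\<dots> = ennreal ((2 * R) ^ m)" using R by (intro emeasure_centered_box) auto
  finally have "(\<integral>\<^sup>+x. ennreal (\<bar>indicator (ball_Rn m R) x\<bar> powr p) \<partial>?L) \<le> ennreal ((2 * R) ^ m)" .
  then have "epow (1 / p) (\<integral>\<^sup>+x. ennreal (\<bar>indicator (ball_Rn m R) x\<bar> powr p) \<partial>?L)
      \<le> epow (1 / p) (ennreal ((2 * R) ^ m))"
    using p by (intro epow_mono) auto
  then show ?thesis
    using R by (simp add: Lp_norm_eq_epow lebesgue_Rn_def nn_integral_completion epow_ennreal)
qed

lemma mi_proj_in_ball_Rn: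
  assumes "\<gamma> \<in> multi_indices n" "x \<in> ball_Rn n R"
  shows "mi_proj n \<gamma> x \<in> ball_Rn (mi_size n \<gamma>) R"
proof -
  have "(\<Sum>k<mi_size n \<gamma>. (mi_proj n \<gamma> x k)\<^sup>2) \<le> (\<Sum>k<n. (x k)\<^sup>2)"
    unfolding sum_mi_proj[OF assms(1), of "\<lambda>t. t\<^sup>2"] by (intro sum_mono2) auto
  then have "L2_set (mi_proj n \<gamma> x) {..<mi_size n \<gamma>} \<le> L2_set x {..<n}"
    by (simp add: L2_set_def)
  then show ?thesis
    using assms(2) by (auto simp: ball_Rn_def lebesgue_Rn_def space_PiM mi_proj_eq)
qed

section \<open>The multilinear inequality\<close>

lemma power_powr_power:
  assumes "0 < (b::real)"
  shows "((b ^ m) powr q) ^ k = b powr (real m * real k * q)"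
  using assms by (simp add: powr_powr powr_realpow[symmetric] powr_power mult_ac)

lemma powr_not_bounded:
  assumes "0 < \<epsilon>"
  shows "\<exists>R>0. K < (R::real) powr \<epsilon>"
proof (intro exI conjI)
  let ?R = "(\<bar>K\<bar> + 1) powr (1 / \<epsilon>)"
  show "0 < ?R" by simp
  show "K < ?R powr \<epsilon>" using assms by (simp add: powr_powr)
qed

context
  fixes n N :: nat and a :: "nat \<Rightarrow> nat" and \<alpha> :: "nat \<Rightarrow> nat \<Rightarrow> nat \<Rightarrow> nat"
  assumes n: "2 \<le> n" and N: "1 \<le> N"
    and decr: "\<And>i. i \<in> {1..N} \<Longrightarrow> a i \<le> a 1"
    and a1: "1 \<le> a 1" "a 1 < n"
    and le: "(\<Sum>i=1..N. a i) \<le> n"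
    and bij: "bij_betw \<alpha> {1..J_max n N a} (balanced_tuples n N a)"
begin

lemma \<alpha>_in: "J \<in> {1..J_max n N a} \<Longrightarrow> \<alpha> J \<in> balanced_tuples n N a"
  using bij_betwE[OF bij] by blast

lemma \<alpha>1_multi_index: "J \<in> {1..J_max n N a} \<Longrightarrow> \<alpha> J 1 \<in> multi_indices n"
  using balanced_tuplesD(1)[OF \<alpha>_in, of J 1] N by simp

lemma mi_size_compl_\<alpha>1: "J \<in> {1..J_max n N a} \<Longrightarrow> mi_size n (mi_compl n (\<alpha> J 1)) = n - a 1"
  using balanced_tuplesD(2)[OF \<alpha>_in, of J 1] N by (simp add: mi_size_mi_compl \<alpha>1_multi_index[simplified])

text \<open>The lower bound of \<open>p_tilde_ge\<close> is positive because \<open>a 1 < n\<close>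
  and \<open>J_max\<close> divides a factorial.\<close>

lemma p_tilde_pos: "0 < p_tilde n N a"
proof -
  have "J_max n N a \<noteq> 0"
    using J_max_mult[OF le] by (metis fact_nonzero mult_zero_left)
  then have "0 < real (J_max n N a) * (1 - real (a 1) / real n)"
    using a1 by (intro mult_pos_pos) auto
  then show ?thesis using p_tilde_ge[OF n N decr a1(1) le] by linarith
qed

text \<open>The shape of the exponent in \<open>local_Finner_inequality\<close>, with
  \<open>m = n - a 1\<close>.\<close>

lemma delta_tilde_eq:
  "delta_tilde n N a = real n - real (n - a 1) * real (card {1..J_max n N a}) / p_tilde n N a"
  using a1 by (simp add: delta_tilde_def of_nat_diff divide_inverse mult_ac)

lemma ball_inequality_delta_tilde: "ball_inequality n N a \<alpha> (delta_tilde n N a)"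
  unfolding ball_inequality_def
proof (intro exI conjI allI impI)
  let ?S = "{1..J_max n N a}" and ?p = "p_tilde n N a" and ?m = "n - a 1"
  let ?\<delta> = "delta_tilde n N a"
  let ?t = "\<lambda>J. mi_coord n (mi_compl n (\<alpha> J 1))"
  \<comment> \<open>The constant is what remains of \<open>(2 * R) powr ?\<delta>\<close> once the
    power of \<open>R\<close> is split off.\<close>
  show "(0::real) < 2 powr ?\<delta>" by simp
  fix R :: real and f :: "nat \<Rightarrow> (nat \<Rightarrow> real) \<Rightarrow> real"
  assume R: "0 < R"
    and f: "\<forall>J\<in>?S. f J \<in> borel_measurable (lebesgue_Rn ?m) \<and>
      (\<forall>z\<in>space (lebesgue_Rn ?m). 0 \<le> f J z) \<and>
      block_symmetric n N (\<alpha> J) (\<lambda>x. f J (mi_proj n (mi_compl n (\<alpha> J 1)) x))"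
  have proj: "mi_proj n (mi_compl n (\<alpha> J 1)) x = (\<lambda>k\<in>{..<?m}. x (?t J k))" if "J \<in> ?S" for J x
    unfolding mi_proj_eq mi_size_compl_\<alpha>1[OF that] ..
  have coord: "bij_betw (?t J) {..<?m} {l. l < n \<and> \<alpha> J 1 l = 0}" if "J \<in> ?S" for J
    using bij_betw_mi_coord[OF mi_compl_in_multi_indices, of n "\<alpha> J 1"]
    unfolding mi_size_compl_\<alpha>1[OF that] mi_compl_support .
  have count: "real (card {J\<in>?S. k \<in> ?t J ` {..<?m}}) \<le> ?p" if k: "k < n" for k
  proof -
    \<comment> \<open>Coordinate \<open>k\<close> is selected by \<open>?t J\<close> exactly when it
      lies outside the first block; the enumeration \<alpha> then carries the count over to balanced
      tuples.\<close>
    have eq: "{J\<in>?S. k \<in> ?t J ` {..<?m}} = {J\<in>?S. \<alpha> J 1 k = 0}"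
      using bij_betw_imp_surj_on[OF coord] k by auto
    have "bij_betw \<alpha> {J\<in>?S. \<alpha> J 1 k = 0} {\<beta> \<in> balanced_tuples n N a. \<beta> 1 k = 0}"
      using bij
    proof (rule bij_betw_subset)
      show "\<alpha> ` {J\<in>?S. \<alpha> J 1 k = 0} = {\<beta> \<in> balanced_tuples n N a. \<beta> 1 k = 0}"
        unfolding bij_betw_imp_surj_on[OF bij, symmetric] by auto
    qed auto
    then have "card {J\<in>?S. \<alpha> J 1 k = 0} = card {\<beta> \<in> balanced_tuples n N a. \<beta> 1 k = 0}"
      by (rule bij_betw_same_card)
    also have "real \<dots> = real (J_max n N a) * (1 - real (a 1) / real n)"
      using N k le by (intro card_balanced_tuples_avoiding) auto
    also have "\<dots> \<le> ?p" using n N decr a1(1) le by (rule p_tilde_ge)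
    finally show ?thesis unfolding eq .
  qed
  have "(\<integral>\<^sup>+x\<in>ball_Rn n R. ennreal (\<Prod>J\<in>?S. f J (mi_proj n (mi_compl n (\<alpha> J 1)) x)) \<partial>lebesgue_Rn n)
      = (\<integral>\<^sup>+x\<in>ball_Rn n R. ennreal (\<Prod>J\<in>?S. f J (\<lambda>k\<in>{..<?m}. x (?t J k))) \<partial>lebesgue_Rn n)"
    by (simp only: proj cong: prod.cong)
  also have "\<dots> \<le> ennreal ((2 * R) powr ?\<delta>) * (\<Prod>J\<in>?S. Lp_norm (lebesgue_Rn ?m) ?p (f J))"
    unfolding delta_tilde_eq
  proof (rule local_Finner_inequality)
    show "inj_on (?t J) {..<?m}" if "J \<in> ?S" for J
      using coord[OF that] by (rule bij_betw_imp_inj_on)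
    show "?t J \<in> {..<?m} \<rightarrow> {..<n}" if "J \<in> ?S" for J
      using bij_betwE[OF coord[OF that]] by auto
  qed (use f R p_tilde_pos count in auto)
  also have "(2 * R) powr ?\<delta> = 2 powr ?\<delta> * R powr ?\<delta>"
    using R by (simp add: powr_mult)
  finally show "(\<integral>\<^sup>+x\<in>ball_Rn n R. ennreal (\<Prod>J\<in>?S. f J (mi_proj n (mi_compl n (\<alpha> J 1)) x)) \<partial>lebesgue_Rn n)
      \<le> ennreal (2 powr ?\<delta> * R powr ?\<delta>) * (\<Prod>J\<in>?S. Lp_norm (lebesgue_Rn ?m) ?p (f J))" .
qed

text \<open>For indicators of balls of radius \<open>R\<close> the left-hand side is at least of
  order \<open>R powr n\<close>, and the right-hand side at most of order
  \<open>R powr (n - (delta_tilde - \<delta>))\<close>, which is too small for large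
  \<open>R\<close>.\<close>

lemma delta_tilde_sharp:
  assumes \<delta>: "\<delta> < delta_tilde n N a"
  shows "\<not> ball_inequality n N a \<alpha> \<delta>"
proof
  let ?S = "{1..J_max n N a}" and ?p = "p_tilde n N a" and ?m = "n - a 1"
  let ?\<delta> = "delta_tilde n N a"
  assume "ball_inequality n N a \<alpha> \<delta>"
  then obtain C where C: "0 < C" and ineq: "\<And>R f. 0 < R \<Longrightarrow>
      (\<forall>J\<in>?S. f J \<in> borel_measurable (lebesgue_Rn ?m) \<and>
          (\<forall>z\<in>space (lebesgue_Rn ?m). 0 \<le> f J z) \<and>
          block_symmetric n N (\<alpha> J) (\<lambda>x. f J (mi_proj n (mi_compl n (\<alpha> J 1)) x))) \<Longrightarrow>
      (\<integral>\<^sup>+x\<in>ball_Rn n R. ennreal (\<Prod>J\<in>?S. f J (mi_proj n (mi_compl n (\<alpha> J 1)) x)) \<partial>lebesgue_Rn n)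
        \<le> ennreal (C * R powr \<delta>) * (\<Prod>J\<in>?S. Lp_norm (lebesgue_Rn ?m) ?p (f J))"
    unfolding ball_inequality_def by blast
  have bound: "(2 * (R / (real n + 1))) ^ n \<le> C * R powr \<delta> * (2 * R) powr (real n - ?\<delta>)" if R: "0 < R" for R
  proof -
    let ?f = "indicator (ball_Rn ?m R) :: (nat \<Rightarrow> real) \<Rightarrow> real"
    have sym: "block_symmetric n N (\<alpha> J) (\<lambda>x. ?f (mi_proj n (mi_compl n (\<alpha> J 1)) x))"
      if J: "J \<in> ?S" for J
    proof -
      \<comment> \<open>Writing the indicator as a function of the sum of squares makes it an
        instance of the invariance lemma.\<close>
      have "?f (mi_proj n (mi_compl n (\<alpha> J 1)) x)
          = indicator {s. sqrt s < R} (\<Sum>k<mi_size n (mi_compl n (\<alpha> J 1)). (mi_proj n (mi_compl n (\<alpha> J 1)) x k)\<^sup>2)" for x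
        by (simp add: indicator_def ball_Rn_def lebesgue_Rn_def space_PiM L2_set_def
            mi_size_compl_\<alpha>1[OF J] mi_proj_eq del: One_nat_def)
      then show ?thesis using block_symmetric_norm_compl[OF N \<alpha>_in[OF J]] by simp
    qed
    have "ennreal ((2 * (R / (real n + 1))) ^ n) \<le> (\<integral>\<^sup>+x. indicator (ball_Rn n R) x \<partial>lebesgue_Rn n)"
      by (rule emeasure_ball_Rn_ge[OF R])
    also have "\<dots> \<le> (\<integral>\<^sup>+x\<in>ball_Rn n R. ennreal (\<Prod>J\<in>?S. ?f (mi_proj n (mi_compl n (\<alpha> J 1)) x)) \<partial>lebesgue_Rn n)"
    proof (intro nn_integral_mono)
      fix x
      \<comment> \<open>Dropping coordinates does not increase the norm, so on the ball all factors,
        and hence the product, equal 1.\<close>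
      have "?f (mi_proj n (mi_compl n (\<alpha> J 1)) x) = 1" if "x \<in> ball_Rn n R" "J \<in> ?S" for J
        using mi_proj_in_ball_Rn[OF mi_compl_in_multi_indices that(1), of "\<alpha> J 1"]
        by (simp add: mi_size_compl_\<alpha>1[OF that(2)] del: One_nat_def)
      then have "(\<Prod>J\<in>?S. ?f (mi_proj n (mi_compl n (\<alpha> J 1)) x)) = 1" if "x \<in> ball_Rn n R"
        using that by (intro prod.neutral) auto
      then show "indicator (ball_Rn n R) x
          \<le> ennreal (\<Prod>J\<in>?S. ?f (mi_proj n (mi_compl n (\<alpha> J 1)) x)) * indicator (ball_Rn n R) x"
        by (cases "x \<in> ball_Rn n R") auto
    qed
    also have "\<dots> \<le> ennreal (C * R powr \<delta>) * (\<Prod>J\<in>?S. Lp_norm (lebesgue_Rn ?m) ?p ?f)"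
      using R sym ball_Rn_in_sets by (intro ineq) auto
    also have "\<dots> \<le> ennreal (C * R powr \<delta>) * (\<Prod>J\<in>?S. ennreal (((2 * R) ^ ?m) powr (1 / ?p)))"
      by (intro mult_left_mono prod_mono_ennreal Lp_norm_indicator_ball_Rn_le R p_tilde_pos) auto
    also have "\<dots> = ennreal (C * R powr \<delta> * (((2 * R) ^ ?m) powr (1 / ?p)) ^ card ?S)"
      using C by (simp add: ennreal_power ennreal_mult)
    also have "(((2 * R) ^ ?m) powr (1 / ?p)) ^ card ?S = (2 * R) powr (real n - ?\<delta>)"
      unfolding delta_tilde_eq using R by (subst power_powr_power) auto
    finally show ?thesis using C R by (simp add: ennreal_le_iff)
  qed
  define c where "c = (2 / (real n + 1)) ^ n"
  have c: "0 < c" by (simp add: c_def)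
  \<comment> \<open>The threshold is the one obtained by dividing \<open>bound\<close> by
    \<open>c\<close> and the common powers of \<open>R\<close>.\<close>
  obtain R where R: "0 < R" and big: "C * 2 powr (real n - ?\<delta>) / c < R powr (?\<delta> - \<delta>)"
    using powr_not_bounded[of "?\<delta> - \<delta>" "C * 2 powr (real n - ?\<delta>) / c"] \<delta> by auto
  have "c * R powr real n = (2 * (R / (real n + 1))) ^ n"
    using R by (simp add: c_def powr_realpow power_mult_distrib power_divide)
  also have "\<dots> \<le> C * R powr \<delta> * (2 * R) powr (real n - ?\<delta>)" by (rule bound[OF R])
  also have "\<dots> = C * 2 powr (real n - ?\<delta>) * R powr (real n - (?\<delta> - \<delta>))"
    using R by (simp add: powr_mult powr_add[symmetric] algebra_simps)
  also have "\<dots> = C * 2 powr (real n - ?\<delta>) * (R powr real n / R powr (?\<delta> - \<delta>))"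
    by (simp only: powr_diff)
  finally have "c * R powr (?\<delta> - \<delta>) \<le> C * 2 powr (real n - ?\<delta>)"
    using R by (simp add: field_simps)
  then show False using big c by (simp add: field_simps)
qed

end

theorem proposition5p3:
  fixes n N :: nat
    and a :: "nat \<Rightarrow> nat"
    and \<alpha> :: "nat \<Rightarrow> nat \<Rightarrow> nat \<Rightarrow> nat"
  assumes "n \<ge> 3"
    and "N \<ge> 1"
    and "\<forall>i\<in>{1..N}. \<forall>j\<in>{1..N}. i \<le> j \<longrightarrow> a j \<le> a i"
    and "\<forall>i\<in>{1..N}. a i \<ge> 2"
    and "(\<Sum>i=1..N. a i) \<le> n"
    and "a 1 \<le> n - 1"
    and "bij_betw \<alpha> {1..J_max n N a} (balanced_tuples n N a)"
  shows "ball_inequality n N a \<alpha> (delta_tilde n N a) \<and>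
    (\<forall>\<delta> < delta_tilde n N a. \<not> ball_inequality n N a \<alpha> \<delta>)"
proof -
  have "2 \<le> a 1" using assms(2,4) by simp
  then have 1: "2 \<le> n" "1 \<le> a 1" "a 1 < n" using assms(1,6) by auto
  have decr: "a i \<le> a 1" if "i \<in> {1..N}" for i
    using assms(2,3) that by simp
  show ?thesis
    using ball_inequality_delta_tilde[OF 1(1) assms(2) decr 1(2,3) assms(5,7)]
      delta_tilde_sharp[OF 1(1) assms(2) decr 1(2,3) assms(5,7)] by blast
qed

end
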